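(* Let $\phi \colon \mathbb{D}\to \mathbb{D}$ be an analytic self-map. If the composition operator $C_\phi \colon H^2 \to H^2$ is in the Schatten class $S_p$ for some $p > 0$, then, as $h$ goes to $0^+$: $$\rho_\phi (h) = o\left( h \left( \log \frac{1}{h} \right)^{-2/p} \right).$$
   Context: $\mathbb{D}$ is the open unit disc of $\mathbb{C}$, $\mathbb{T}=\partial\mathbb{D}$ with normalized Lebesgue measure $m$, and $H^2$ the Hardy space on $\mathbb{D}$. For an analytic self-map $\phi\colon\mathbb{D}\to\mathbb{D}$ with radial boundary values $\phi^\ast$, $C_\phi(f)=f\circ\phi$ and $m_\phi$ is the measure on $\mathbb{D}$ given by $m_\phi(B) = m(\{\xi\in\mathbb{T} : \phi^\ast(\xi)\in B\})$ for Borel sets $B\subseteq\mathbb{D}$. For $\xi\in\mathbb{T}$ and $0<h<1$, the Carleson window is $W(\xi,h) = \{z\in\mathbb{D} : |z|\ge 1-h \text{ and } |\arg(z\bar\xi)|\le h\}$. The Carleson function of $\phi$ is $\rho_\phi(h) = \sup_{\xi\in\mathbb{T}} m_\phi[W(\xi,h)]$. For $p>0$, $S_p$ is the Schatten class of operators on $H^2$, i.e. the compact operators whose sequence of singular numbers is in $\ell^p$. *)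

theory Defs
  imports "HOL-Complex_Analysis.Complex_Analysis" "HOL-Library.Landau_Symbols"
begin

section \<open>The Hardy space on the unit disc\<close>

definition taylor_coeff :: "(complex \<Rightarrow> complex) \<Rightarrow> nat \<Rightarrow> complex" where
  "taylor_coeff f n = (deriv ^^ n) f 0 / fact n"

text \<open>The Hardy space consists of the analytic functions on the disc with square-summable Taylor
  coefficients. Elements are normalised to vanish off the disc, so that equality of elements is
  equality of functions on the disc.\<close>

definition hardy2_set :: "(complex \<Rightarrow> complex) set" where
  "hardy2_set = {f. f holomorphic_on ball 0 1 \<and> (\<forall>z. z \<notin> ball 0 1 \<longrightarrow> f z = 0) \<and>
                    summable (\<lambda>n. (cmod (taylor_coeff f n))\<^sup>2)}"

lemma taylor_coeff_add:
  assumes "f holomorphic_on ball 0 1" "g holomorphic_on ball 0 1"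
  shows "taylor_coeff (\<lambda>z. f z + g z) n = taylor_coeff f n + taylor_coeff g n"
  using higher_deriv_add[OF assms, of 0 n] by (simp add: taylor_coeff_def add_divide_distrib)

lemma taylor_coeff_cmult:
  assumes "f holomorphic_on ball 0 1"
  shows "taylor_coeff (\<lambda>z. c * f z) n = c * taylor_coeff f n"
  using higher_deriv_cmult[OF assms, of 0 n c] by (simp add: taylor_coeff_def)

lemma taylor_coeff_zero: "taylor_coeff (\<lambda>z. 0) n = 0"
  using taylor_coeff_cmult[of "\<lambda>z. 0" 0 n] by simp

lemma summable_norm_add_sq:
  fixes a b :: "nat \<Rightarrow> complex"
  assumes "summable (\<lambda>n. (cmod (a n))\<^sup>2)" "summable (\<lambda>n. (cmod (b n))\<^sup>2)"
  shows "summable (\<lambda>n. (cmod (a n + b n))\<^sup>2)"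
proof (rule summable_comparison_test)
  show "summable (\<lambda>n. 2 * (cmod (a n))\<^sup>2 + 2 * (cmod (b n))\<^sup>2)"
    using assms by (intro summable_add summable_mult)
  have "(cmod (a n + b n))\<^sup>2 \<le> 2 * (cmod (a n))\<^sup>2 + 2 * (cmod (b n))\<^sup>2" for n
  proof -
    have "(cmod (a n + b n))\<^sup>2 \<le> (cmod (a n) + cmod (b n))\<^sup>2"
      by (intro power_mono norm_triangle_ineq) auto
    also have "\<dots> \<le> 2 * (cmod (a n))\<^sup>2 + 2 * (cmod (b n))\<^sup>2"
      using sum_squares_bound[of "cmod (a n)" "cmod (b n)"] by (simp add: power2_sum)
    finally show ?thesis .
  qed
  then show "\<exists>N. \<forall>n\<ge>N. norm ((cmod (a n + b n))\<^sup>2) \<le> 2 * (cmod (a n))\<^sup>2 + 2 * (cmod (b n))\<^sup>2"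
    by simp
qed

lemma hardy2_set_zero: "(\<lambda>z. 0) \<in> hardy2_set"
  by (simp add: hardy2_set_def taylor_coeff_zero)

lemma hardy2_set_add:
  assumes "f \<in> hardy2_set" "g \<in> hardy2_set"
  shows "(\<lambda>z. f z + g z) \<in> hardy2_set"
  using assms
  by (auto simp: hardy2_set_def taylor_coeff_add intro!: holomorphic_on_add summable_norm_add_sq)

lemma hardy2_set_cmult:
  assumes "f \<in> hardy2_set"
  shows "(\<lambda>z. c * f z) \<in> hardy2_set"
  using assms
  by (auto simp: hardy2_set_def taylor_coeff_cmult norm_mult power_mult_distrib
           intro!: holomorphic_on_mult summable_mult)

typedef hardy2 = hardy2_set
  morphisms hardy_fun Abs_hardy2
  using hardy2_set_zero by blast

abbreviation hcoeff :: "hardy2 \<Rightarrow> nat \<Rightarrow> complex" where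
  "hcoeff f \<equiv> taylor_coeff (hardy_fun f)"

lemma hardy_fun_holomorphic: "hardy_fun f holomorphic_on ball 0 1"
  using hardy_fun[of f] by (simp add: hardy2_set_def)

lemma summable_hcoeff: "summable (\<lambda>n. (cmod (hcoeff f n))\<^sup>2)"
  using hardy_fun[of f] by (simp add: hardy2_set_def)

lemma hardy2_eqI: "(\<And>z. hardy_fun f z = hardy_fun g z) \<Longrightarrow> f = g"
  by (metis ext hardy_fun_inject)

text \<open>Multiplication by complex scalars; the class structure below only covers real ones.\<close>

definition hscale :: "complex \<Rightarrow> hardy2 \<Rightarrow> hardy2" where
  "hscale c f = Abs_hardy2 (\<lambda>z. c * hardy_fun f z)"

lemma hardy_fun_hscale: "hardy_fun (hscale c f) z = c * hardy_fun f z"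
  by (simp add: hscale_def Abs_hardy2_inverse hardy2_set_cmult hardy_fun)

text \<open>The inner product is the real part of the Hermitian product
  \<open>\<Sum>n. hcoeff f n * cnj (hcoeff g n)\<close>; the norm is the usual one.\<close>

instantiation hardy2 :: real_inner
begin

definition zero_hardy2 :: hardy2 where
  "0 = Abs_hardy2 (\<lambda>z. 0)"

definition plus_hardy2 :: "hardy2 \<Rightarrow> hardy2 \<Rightarrow> hardy2" where
  "f + g = Abs_hardy2 (\<lambda>z. hardy_fun f z + hardy_fun g z)"

definition scaleR_hardy2 :: "real \<Rightarrow> hardy2 \<Rightarrow> hardy2" where
  "r *\<^sub>R f = hscale (complex_of_real r) f"

definition uminus_hardy2 :: "hardy2 \<Rightarrow> hardy2" where
  "- f = hscale (- 1) f"

definition minus_hardy2 :: "hardy2 \<Rightarrow> hardy2 \<Rightarrow> hardy2" where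
  "f - g = f + - (g :: hardy2)"

definition inner_hardy2 :: "hardy2 \<Rightarrow> hardy2 \<Rightarrow> real" where
  "f \<bullet> g = Re (\<Sum>n. hcoeff f n * cnj (hcoeff g n))"

definition norm_hardy2 :: "hardy2 \<Rightarrow> real" where
  "norm (f :: hardy2) = sqrt (f \<bullet> f)"

definition sgn_hardy2 :: "hardy2 \<Rightarrow> hardy2" where
  "sgn f = inverse (norm f) *\<^sub>R (f :: hardy2)"

definition dist_hardy2 :: "hardy2 \<Rightarrow> hardy2 \<Rightarrow> real" where
  "dist f g = norm (f - g :: hardy2)"

definition uniformity_hardy2 :: "(hardy2 \<times> hardy2) filter" where
  "uniformity_hardy2 = (INF e\<in>{0 <..}. principal {(f, g). dist f g < e})"

definition open_hardy2 :: "hardy2 set \<Rightarrow> bool" where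
  "open_hardy2 U \<longleftrightarrow> (\<forall>f\<in>U. eventually (\<lambda>(f', g). f' = f \<longrightarrow> g \<in> U) uniformity)"

lemma hardy_fun_zero: "hardy_fun 0 z = 0"
  by (simp add: zero_hardy2_def Abs_hardy2_inverse hardy2_set_zero)

lemma hardy_fun_add: "hardy_fun (f + g) z = hardy_fun f z + hardy_fun g z"
  by (simp add: plus_hardy2_def Abs_hardy2_inverse hardy2_set_add hardy_fun)

lemma hcoeff_add: "hcoeff (f + g) n = hcoeff f n + hcoeff g n"
proof -
  have "hardy_fun (f + g) = (\<lambda>z. hardy_fun f z + hardy_fun g z)"
    by (simp add: fun_eq_iff hardy_fun_add)
  then show ?thesis
    by (simp add: taylor_coeff_add hardy_fun_holomorphic)
qed

lemma hcoeff_hscale: "hcoeff (hscale c f) n = c * hcoeff f n"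
proof -
  have "hardy_fun (hscale c f) = (\<lambda>z. c * hardy_fun f z)"
    by (simp add: fun_eq_iff hardy_fun_hscale)
  then show ?thesis
    by (simp add: taylor_coeff_cmult hardy_fun_holomorphic)
qed

lemma summable_hcoeff_mult: "summable (\<lambda>n. hcoeff f n * cnj (hcoeff g n))"
proof (rule summable_comparison_test)
  show "summable (\<lambda>n. (cmod (hcoeff f n))\<^sup>2 + (cmod (hcoeff g n))\<^sup>2)"
    by (intro summable_add summable_hcoeff)
  have "cmod (hcoeff f n) * cmod (hcoeff g n) \<le> (cmod (hcoeff f n))\<^sup>2 + (cmod (hcoeff g n))\<^sup>2" for n
  proof -
    have "2 * (cmod (hcoeff f n) * cmod (hcoeff g n))
            \<le> (cmod (hcoeff f n))\<^sup>2 + (cmod (hcoeff g n))\<^sup>2"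
      using sum_squares_bound[of "cmod (hcoeff f n)" "cmod (hcoeff g n)"] by simp
    moreover have "0 \<le> cmod (hcoeff f n) * cmod (hcoeff g n)"
      by simp
    ultimately show ?thesis by linarith
  qed
  then show "\<exists>N. \<forall>n\<ge>N. norm (hcoeff f n * cnj (hcoeff g n))
                          \<le> (cmod (hcoeff f n))\<^sup>2 + (cmod (hcoeff g n))\<^sup>2"
    by (simp add: norm_mult)
qed

lemma inner_hardy2_altdef: "f \<bullet> g = (\<Sum>n. Re (hcoeff f n * cnj (hcoeff g n)))"
  unfolding inner_hardy2_def by (rule Re_suminf[OF summable_hcoeff_mult])

lemma summable_Re_hcoeff_mult: "summable (\<lambda>n. Re (hcoeff f n * cnj (hcoeff g n)))"
  by (rule summable_Re[OF summable_hcoeff_mult])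

lemma inner_hardy2_self: "f \<bullet> f = (\<Sum>n. (cmod (hcoeff f n))\<^sup>2)"
  unfolding inner_hardy2_altdef by (simp add: complex_norm_square[symmetric] cmod_power2 power2_eq_square)

instance
proof
  fix f g h :: hardy2 and r s :: real
  show "f + g + h = f + (g + h)" "f + g = g + f" "0 + f = f" "- f + f = 0" "f - g = f + - g"
    by (auto intro!: hardy2_eqI
        simp: hardy_fun_add hardy_fun_zero minus_hardy2_def uminus_hardy2_def hardy_fun_hscale)
  show "r *\<^sub>R (f + g) = r *\<^sub>R f + r *\<^sub>R g" "(r + s) *\<^sub>R f = r *\<^sub>R f + s *\<^sub>R f"
    "r *\<^sub>R s *\<^sub>R f = (r * s) *\<^sub>R f" "1 *\<^sub>R f = f"
    by (auto intro!: hardy2_eqI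
        simp: hardy_fun_add scaleR_hardy2_def hardy_fun_hscale algebra_simps)
  show "sgn f = inverse (norm f) *\<^sub>R f" "dist f g = norm (f - g)" "norm f = sqrt (f \<bullet> f)"
    by (rule sgn_hardy2_def dist_hardy2_def norm_hardy2_def)+
  show "(uniformity :: (hardy2 \<times> hardy2) filter) = (INF e\<in>{0 <..}. principal {(f, g). dist f g < e})"
    by (rule uniformity_hardy2_def)
  show "open U \<longleftrightarrow> (\<forall>f\<in>U. eventually (\<lambda>(f', g). f' = f \<longrightarrow> g \<in> U) uniformity)" for U :: "hardy2 set"
    by (rule open_hardy2_def)
  show "f \<bullet> g = g \<bullet> f"
    by (simp add: inner_hardy2_altdef mult.commute)
  show "(f + g) \<bullet> h = f \<bullet> h + g \<bullet> h"
    using suminf_add[OF summable_Re_hcoeff_mult[of f h] summable_Re_hcoeff_mult[of g h]]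
    by (simp add: inner_hardy2_altdef hcoeff_add algebra_simps)
  show "(r *\<^sub>R f) \<bullet> g = r * (f \<bullet> g)"
    using suminf_mult[OF summable_Re_hcoeff_mult[of f g], of r]
    by (simp add: inner_hardy2_altdef scaleR_hardy2_def hcoeff_hscale algebra_simps)
  show "0 \<le> f \<bullet> f"
    unfolding inner_hardy2_self by (rule suminf_nonneg[OF summable_hcoeff]) simp
  show "f \<bullet> f = 0 \<longleftrightarrow> f = 0"
  proof
    assume "f \<bullet> f = 0"
    then have "\<forall>n. (cmod (hcoeff f n))\<^sup>2 = 0"
      unfolding inner_hardy2_self by (subst (asm) suminf_eq_zero_iff[OF summable_hcoeff]) auto
    then have coeff: "(deriv ^^ n) (hardy_fun f) 0 = 0" for n
      by (simp add: taylor_coeff_def)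
    show "f = 0"
    proof (rule hardy2_eqI)
      fix z
      show "hardy_fun f z = hardy_fun 0 z"
      proof (cases "z \<in> ball 0 1")
        case True
        then show ?thesis
          using holomorphic_fun_eq_0_on_ball[OF hardy_fun_holomorphic True coeff]
          by (simp add: hardy_fun_zero)
      next
        case False
        then show ?thesis
          using hardy_fun[of f] by (simp add: hardy2_set_def hardy_fun_zero)
      qed
    qed
  next
    assume "f = 0"
    moreover have "hardy_fun 0 = (\<lambda>z. 0)"
      by (simp add: fun_eq_iff hardy_fun_zero)
    ultimately show "f \<bullet> f = 0"
      by (simp add: inner_hardy2_self taylor_coeff_zero)
  qed
qed

end

lemma vector_space_hscale: "vector_space hscale"
  by unfold_locales
    (auto intro!: hardy2_eqI simp: hardy_fun_hscale hardy_fun_add algebra_simps)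

section \<open>Schatten classes\<close>

text \<open>The closure condition implies boundedness.\<close>

definition compact_operator :: "(hardy2 \<Rightarrow> hardy2) \<Rightarrow> bool" where
  "compact_operator T \<longleftrightarrow>
     Vector_Spaces.linear hscale hscale T \<and> compact (closure (T ` cball 0 1))"

text \<open>The library's \<open>adjoint\<close> is taken with respect to the real inner product. For a bounded
  complex-linear operator it is the usual Hilbert space adjoint: if
  \<open>Re \<langle>T f, g\<rangle> = Re \<langle>f, S g\<rangle>\<close> for all \<open>f\<close>, \<open>g\<close>, then replacing \<open>f\<close> by \<open>\<i> f\<close> gives equality
  of the imaginary parts.

  The singular numbers of \<open>T\<close> are the eigenvalues of \<open>(T\<^sup>* T)\<^sup>1\<^sup>/\<^sup>2\<close>, that is, the nonnegative
  square roots of the eigenvalues of \<open>T\<^sup>* T\<close>, in decreasing order and repeated according to their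
  multiplicity (the complex dimension of the eigenspace), followed by zeros if there are only
  finitely many positive ones. For compact \<open>T\<close> exactly one sequence has the following property.
  Since \<open>s\<close> tends to 0, all the cardinalities are finite.\<close>

definition is_singular_numbers :: "(hardy2 \<Rightarrow> hardy2) \<Rightarrow> (nat \<Rightarrow> real) \<Rightarrow> bool" where
  "is_singular_numbers T s \<longleftrightarrow>
     decseq s \<and> s \<longlonglongrightarrow> 0 \<and>
     (\<forall>\<sigma>>0. card {n. s n = \<sigma>} =
              vector_space.dim hscale {f. adjoint T (T f) = (\<sigma>\<^sup>2) *\<^sub>R f})"

definition schatten_class :: "real \<Rightarrow> (hardy2 \<Rightarrow> hardy2) set" where
  "schatten_class p =
     {T. compact_operator T \<and> (\<exists>s. is_singular_numbers T s \<and> summable (\<lambda>n. s n powr p))}"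

section \<open>Composition operators and the Carleson function\<close>

text \<open>By Littlewood's subordination theorem the composition again lies in the Hardy space for every
  analytic self-map \<open>\<phi>\<close> of the disc, so \<open>Abs_hardy2\<close> is applied to an element of its domain.\<close>

definition composition_operator :: "(complex \<Rightarrow> complex) \<Rightarrow> hardy2 \<Rightarrow> hardy2" where
  "composition_operator \<phi> f = Abs_hardy2 (\<lambda>z. if z \<in> ball 0 1 then hardy_fun f (\<phi> z) else 0)"

definition circle_measure :: "complex measure" where
  "circle_measure = distr (uniform_measure lborel {0..2 * pi}) borel cis"

definition has_radial_limit :: "(complex \<Rightarrow> complex) \<Rightarrow> complex \<Rightarrow> complex \<Rightarrow> bool" where
  "has_radial_limit \<phi> \<xi> w \<longleftrightarrow> ((\<lambda>r. \<phi> (complex_of_real r * \<xi>)) \<longlongrightarrow> w) (at_left 1)"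

text \<open>Points of the circle without a radial limit, a null set by Fatou's theorem, contribute
  nothing.\<close>

definition boundary_measure :: "(complex \<Rightarrow> complex) \<Rightarrow> complex set \<Rightarrow> real" where
  "boundary_measure \<phi> B =
     measure circle_measure {\<xi> \<in> sphere 0 1. \<exists>w\<in>B. has_radial_limit \<phi> \<xi> w}"

definition carleson_window :: "complex \<Rightarrow> real \<Rightarrow> complex set" where
  "carleson_window \<xi> h = {z \<in> ball 0 1. cmod z \<ge> 1 - h \<and> \<bar>Arg (z * cnj \<xi>)\<bar> \<le> h}"

definition carleson_function :: "(complex \<Rightarrow> complex) \<Rightarrow> real \<Rightarrow> real" where
  "carleson_function \<phi> h = (SUP \<xi>\<in>sphere 0 1. boundary_measure \<phi> (carleson_window \<xi> h))"

end

theory Submission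
  imports Defs "HOL-Probability.Probability_Measure" "HOL-Real_Asymp.Real_Asymp"
begin

text \<open>
  For a point \<open>\<xi>\<close> of the circle put \<open>v = 1 - cnj \<xi> * \<phi>\<close>, and let \<open>t\<^sub>i = 5000\<^bsup>2(i+1)\<^esup> h\<close> for \<open>i < N\<close>, where
  \<open>N\<close> is comparable to \<open>log (1/h)\<close>. The multiples \<open>f\<^sub>i = \<surd>t\<^sub>i / (t\<^sub>i + 1 - cnj \<xi> z)\<close> of reproducing kernels
  are almost orthogonal because the \<open>t\<^sub>i\<close> are lacunary, and \<open>f\<^sub>i \<circ> \<phi>\<close> is concentrated on the shell
  \<open>t\<^sub>i/272 < |v| \<le> t\<^sub>i\<close> of the circle. The mass of \<open>{|v| \<le> t}\<close> divided by \<open>t\<close> does not decrease, up to a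
  constant, when \<open>t\<close> grows, so every shell has mass at least a constant times
  \<open>t\<^sub>i m(|v| \<le> h) / h\<close>. Hence \<open>C\<^sub>\<phi>\<close> is bounded below by a multiple of \<open>(m(|v| \<le> h) / h)\<^bsup>1/2\<^esup>\<close> on the
  \<open>N\<close>-dimensional span of the \<open>f\<^sub>i\<close>, which gives \<open>\<rho>\<^sub>\<phi>(h) \<le> C h s\<^sub>N\<^sup>2\<close> with the \<open>N\<close>-th singular number. Finally
  \<open>N s\<^sub>N\<^sup>p \<longlonglongrightarrow> 0\<close>, since the singular numbers decrease and are \<open>p\<close>-summable.
\<close>

section \<open>Mean values on circles\<close>

text \<open>The factor \<open>\<surd>t\<close> in the kernels balances two effects: on its shell the
  square modulus of the composed kernel is of order \<open>1/t\<close>, while the shell mass is of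
  order at least \<open>t m / h\<close>, where \<open>m\<close> is the mass of
  \<open>|v| \<le> h\<close>. The product no longer depends on the shell, so the lower bound is
  uniform on the whole span. The obstacle is that growth of the mass of discs does not by itself
  give mass to shells. Homogeneity with constant 136 is therefore used a second time, between
  \<open>t/272\<close> and \<open>t\<close>: as 272 is twice 136, the inner disc takes at most half
  of the mass. The ratio 5000 for the square roots keeps the shells disjoint and makes the cross
  terms, of size \<open>272 * 2 / 4999\<close>, harmless. Homogeneity only needs
  \<open>Re v > 0\<close>, which is the self-map property seen from \<xi>. It is proved on circles
  of radius \<open>r < 1\<close>, where everything is continuous, with constants free of
  \<open>r\<close>; boundary values appear only in the final limit. Singular numbers are given by
  dimensions of eigenspaces, so the passage from a lower bound on a subspace to a count of
  eigenvalues has to be derived from compactness.\<close>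

definition angle_measure :: "real measure" where
  "angle_measure = uniform_measure lborel {0..2 * pi}"

lemma prob_space_angle: "prob_space angle_measure"
  unfolding angle_measure_def
  by (rule prob_space_uniform_measure) (use pi_gt_zero in \<open>auto simp: ennreal_eq_0_iff simp del: pi_gt_zero\<close>)

interpretation angle: prob_space angle_measure
  by (rule prob_space_angle)

lemma sets_angle [simp, measurable_cong]: "sets angle_measure = sets borel"
  by (simp add: angle_measure_def)

lemma space_angle [simp]: "space angle_measure = UNIV"
  by (simp add: angle_measure_def)

lemma measure_angle_UNIV [simp]: "measure angle_measure UNIV = 1"
  using angle.prob_space by simp

lemma angle_measure_eq_density:
  "angle_measure = density lborel (\<lambda>x. ennreal (indicator {0..2 * pi} x / (2 * pi)))"
proof -
  have "indicator {0..2 * pi} x / emeasure lborel {0..2 * pi} = ennreal (indicator {0..2 * pi} x / (2 * pi))" for x :: real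
    by (auto simp: indicator_def divide_ennreal[symmetric] ennreal_1[symmetric] simp del: ennreal_1)
  then show ?thesis
    unfolding angle_measure_def uniform_measure_def by simp
qed

lemma
  fixes f :: "real \<Rightarrow> 'a::euclidean_space"
  assumes "continuous_on UNIV f"
  shows integrable_angle: "integrable angle_measure f"
    and integral_angle: "integral\<^sup>L angle_measure f = (1 / (2 * pi)) *\<^sub>R integral {0..2 * pi} f"
proof -
  have meas: "f \<in> borel_measurable borel"
    using assms by (rule borel_measurable_continuous_onI)
  have cont: "continuous_on {0..2 * pi} f"
    using assms by (rule continuous_on_subset) auto
  have int: "set_integrable lborel {0..2 * pi} f"
    by (rule borel_integrable_compact[OF _ cont, unfolded set_integrable_def[symmetric]]) auto
  have eq: "(indicator {0..2 * pi} x / (2 * pi)) *\<^sub>R f x = (1 / (2 * pi)) *\<^sub>R (indicator {0..2 * pi} x *\<^sub>R f x)" for x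
    by simp
  have "integrable lborel (\<lambda>x. (indicator {0..2 * pi} x / (2 * pi)) *\<^sub>R f x)"
    unfolding eq using int unfolding set_integrable_def by (rule integrable_scaleR_right)
  then show "integrable angle_measure f"
    unfolding angle_measure_eq_density
    by (subst integrable_density) (use meas in \<open>auto\<close>)
  have "integral\<^sup>L angle_measure f = (LINT x|lborel. (indicator {0..2 * pi} x / (2 * pi)) *\<^sub>R f x)"
    unfolding angle_measure_eq_density
    by (subst integral_density) (use meas in \<open>auto\<close>)
  also have "\<dots> = (1 / (2 * pi)) *\<^sub>R (LINT x:{0..2 * pi}|lborel. f x)"
    unfolding eq set_lebesgue_integral_def by (rule integral_scaleR_right)
  also have "(LINT x:{0..2 * pi}|lborel. f x) = integral {0..2 * pi} f"
    by (rule set_borel_integral_eq_integral(2)[OF int])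
  finally show "integral\<^sup>L angle_measure f = (1 / (2 * pi)) *\<^sub>R integral {0..2 * pi} f" .
qed

text \<open>Rotation invariance of circle means: periodicity moves the part of the shifted interval
  beyond \<open>2 * pi\<close> back to the start. The range of \<open>b\<close> covers the values of
  \<open>Arg2pi\<close>.\<close>

lemma integral_angle_shift:
  fixes f :: "real \<Rightarrow> real"
  assumes cont: "continuous_on UNIV f" and per: "\<And>x. f (x + 2 * pi) = f x"
    and b: "0 \<le> b" "b \<le> 2 * pi"
  shows "(LINT x|angle_measure. f (x + b)) = integral\<^sup>L angle_measure f"
proof -
  have c: "continuous_on A f" for A
    using cont by (rule continuous_on_subset) auto
  have I: "f integrable_on {u..w}" for u w
    by (rule integrable_continuous_interval[OF c])
  have shift: "integral {u..w} (\<lambda>x. f (x + d)) = integral {u + d..w + d} f" for u w d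
    using integral_shift_Icc_real[of u w f d] by (simp add: o_def add.commute)
  have "integral {0..2 * pi} (\<lambda>x. f (x + b)) = integral {b..2 * pi + b} f"
    by (simp add: shift)
  also have "\<dots> = integral {b..2 * pi} f + integral {2 * pi..2 * pi + b} f"
    by (rule Henstock_Kurzweil_Integration.integral_combine[symmetric, OF _ _ I]) (use b in auto)
  also have "integral {2 * pi..2 * pi + b} f = integral {0..b} (\<lambda>x. f (x + 2 * pi))"
    by (simp add: shift add.commute)
  also have "\<dots> = integral {0..b} f"
    by (simp add: per)
  also have "integral {b..2 * pi} f + integral {0..b} f = integral {0..2 * pi} f"
    using Henstock_Kurzweil_Integration.integral_combine[OF _ _ I, of 0 b "2 * pi"] b by simp
  finally have "integral {0..2 * pi} (\<lambda>x. f (x + b)) = integral {0..2 * pi} f" .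
  moreover have "continuous_on UNIV (\<lambda>x. f (x + b))"
    by (rule continuous_on_compose2[OF cont]) (auto intro!: continuous_intros)
  ultimately show ?thesis
    by (simp add: integral_angle cont)
qed

lemma mean_value_circle:
  assumes hol: "G holomorphic_on ball 0 1" and cont: "continuous_on (cball 0 1) G"
  shows "(LINT t|angle_measure. G (cis t)) = G 0"
    and "integrable angle_measure (\<lambda>t. G (cis t))"
proof -
  have c: "continuous_on UNIV (\<lambda>t. G (cis t))"
    by (rule continuous_on_compose2[OF cont]) (auto intro!: continuous_intros)
  then show "integrable angle_measure (\<lambda>t. G (cis t))"
    by (rule integrable_angle)
  have "((\<lambda>u. G u / (u - 0)) has_contour_integral (2 * of_real pi * \<i> * G 0)) (circlepath 0 1)"
    by (rule Cauchy_integral_circlepath) (use assms in auto)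
  then have "((\<lambda>t. G (0 + 1 * cis t) / (0 + 1 * cis t - 0) * 1 * \<i> * cis t) has_integral 2 * of_real pi * \<i> * G 0) {0..2 * pi}"
    unfolding circlepath_def by (subst (asm) has_contour_integral_part_circlepath_iff) auto
  then have "((\<lambda>t. \<i> * G (cis t)) has_integral 2 * of_real pi * \<i> * G 0) {0..2 * pi}"
    by (rule has_integral_eq[rotated]) auto
  then have "((\<lambda>t. (-\<i>) * (\<i> * G (cis t))) has_integral (-\<i>) * (2 * of_real pi * \<i> * G 0)) {0..2 * pi}"
    by (rule has_integral_mult_right)
  moreover have "(-\<i>) * (2 * of_real pi * \<i> * G 0) = 2 * of_real pi * G 0"
    by (simp add: algebra_simps)
  moreover have "(-\<i>) * (\<i> * G (cis t)) = G (cis t)" for t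
    by simp
  ultimately have "((\<lambda>t. G (cis t)) has_integral (2 * of_real pi * G 0)) {0..2 * pi}"
    by (simp only:)
  then have "integral {0..2 * pi} (\<lambda>t. G (cis t)) = 2 * of_real pi * G 0"
    by (rule integral_unique)
  with integral_angle[OF c] show "(LINT t|angle_measure. G (cis t)) = G 0"
    by (simp add: scaleR_conv_of_real)
qed


section \<open>From local to global sub-mean value inequalities\<close>

interpretation angle_pair: pair_prob_space angle_measure angle_measure ..

lemma integral_angle_swap:
  fixes f :: "real \<Rightarrow> real \<Rightarrow> real"
  assumes cont: "continuous_on UNIV (\<lambda>(s, t). f s t)" and bound: "\<And>s t. \<bar>f s t\<bar> \<le> B"
  shows "(LINT s|angle_measure. LINT t|angle_measure. f s t) = (LINT t|angle_measure. LINT s|angle_measure. f s t)"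
    and "integrable angle_measure (\<lambda>s. LINT t|angle_measure. f s t)"
proof -
  have "(\<lambda>(s, t). f s t) \<in> borel_measurable borel"
    by (rule borel_measurable_continuous_onI[OF cont])
  then have meas: "(\<lambda>(s, t). f s t) \<in> borel_measurable (angle_measure \<Otimes>\<^sub>M angle_measure)"
    by (subst measurable_cong_sets[OF sets_pair_measure_cong[OF sets_angle sets_angle] refl])
       (simp add: borel_prod)
  have int: "integrable (angle_measure \<Otimes>\<^sub>M angle_measure) (\<lambda>(s, t). f s t)"
    by (rule angle_pair.integrable_const_bound[OF _ meas, of B]) (use bound in auto)
  show "(LINT s|angle_measure. LINT t|angle_measure. f s t) = (LINT t|angle_measure. LINT s|angle_measure. f s t)"
    using angle_pair.Fubini_integral[OF int] by simp
  show "integrable angle_measure (\<lambda>s. LINT t|angle_measure. f s t)"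
    using angle_pair.integrable_fst[OF int] by simp
qed

text \<open>The average of \<open>u\<close> over rotations inherits the local mean value inequality and is constant on
  circles. After adding \<open>k |z|\<^sup>2\<close>, which makes the inequality strict, it attains its maximum only on
  the boundary.\<close>

lemma le_circle_mean_of_local:
  fixes u :: "complex \<Rightarrow> real"
  assumes r: "0 < r" and cont: "continuous_on (cball 0 r) u" and e: "0 < e"
    and sub: "\<And>x c. norm x + norm c \<le> r \<Longrightarrow> norm c < e \<Longrightarrow>
      u x \<le> (LINT t|angle_measure. u (x + c * cis t))"
  shows "u 0 \<le> (LINT t|angle_measure. u (of_real r * cis t))"
proof -
  define A where "A z = (LINT s|angle_measure. u (z * cis s))" for z
  have uc: "continuous_on S (\<lambda>x. u (g x))" if "continuous_on S g" "\<And>x. x \<in> S \<Longrightarrow> norm (g x) \<le> r"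
    for S and g :: "'x::topological_space \<Rightarrow> complex"
    by (rule continuous_on_compose2[OF cont]) (use that in auto)
  have "compact (u ` cball 0 r)"
    using cont by (intro compact_continuous_image) auto
  then obtain B where B: "\<And>z. norm z \<le> r \<Longrightarrow> \<bar>u z\<bar> \<le> B"
    using compact_imp_bounded[of "u ` cball 0 r"] by (force simp: bounded_iff)
  have contA: "continuous_on (cball 0 r) A"
  proof -
    have "continuous_on (cball 0 r \<times> cbox 0 (2 * pi)) (\<lambda>(z, s). u (z * cis s))"
      unfolding case_prod_unfold
      by (rule uc) (auto intro!: continuous_intros simp: norm_mult)
    then have "continuous_on (cball 0 r) (\<lambda>z. integral (cbox 0 (2 * pi)) (\<lambda>s. u (z * cis s)))"
      by (rule integral_continuous_on_param)
    then have "continuous_on (cball 0 r) (\<lambda>z. (1 / (2 * pi)) *\<^sub>R integral {0..2 * pi} (\<lambda>s. u (z * cis s)))"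
      by (auto intro!: continuous_intros)
    moreover have "A z = (1 / (2 * pi)) *\<^sub>R integral {0..2 * pi} (\<lambda>s. u (z * cis s))" if "z \<in> cball 0 r" for z
      unfolding A_def
      by (rule integral_angle, rule uc) (use that in \<open>auto intro!: continuous_intros simp: norm_mult\<close>)
    ultimately show ?thesis
      by (metis (no_types, lifting) continuous_on_cong)
  qed
  \<comment> \<open>The local inequality is used at the rotated point \<open>x * cis s\<close> with
    displacement \<open>c * cis s\<close>, whose moduli are unchanged; Fubini then exchanges the
    rotation average and the circle average.\<close>
  have subA: "A x \<le> (LINT t|angle_measure. A (x + c * cis t))" if c: "norm x + norm c \<le> r" "norm c < e" for x c
  proof -
    have le: "norm (x + c * cis t) \<le> r" for t
      using norm_triangle_ineq[of x "c * cis t"] c by (simp add: norm_mult)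
    have c2: "continuous_on UNIV (\<lambda>(s, t). u ((x + c * cis t) * cis s))"
      unfolding case_prod_unfold
      by (rule uc) (auto intro!: continuous_intros simp: norm_mult le)
    have bd: "\<bar>u ((x + c * cis t) * cis s)\<bar> \<le> B" for s t
      by (rule B) (simp add: norm_mult le)
    have "norm x \<le> r"
      using c norm_ge_zero[of c] by linarith
    then have "A x \<le> (LINT s|angle_measure. LINT t|angle_measure. u ((x + c * cis t) * cis s))"
      unfolding A_def
    proof (intro integral_mono)
      show "integrable angle_measure (\<lambda>s. u (x * cis s))"
        by (rule integrable_angle, rule uc) (use \<open>norm x \<le> r\<close> in \<open>auto intro!: continuous_intros simp: norm_mult\<close>)
      show "integrable angle_measure (\<lambda>s. LINT t|angle_measure. u ((x + c * cis t) * cis s))"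
        by (rule integral_angle_swap(2)[OF c2 bd])
      show "u (x * cis s) \<le> (LINT t|angle_measure. u ((x + c * cis t) * cis s))" for s
        using sub[of "x * cis s" "c * cis s"] c by (simp add: norm_mult algebra_simps)
    qed
    also have "\<dots> = (LINT t|angle_measure. LINT s|angle_measure. u ((x + c * cis t) * cis s))"
      by (rule integral_angle_swap(1)[OF c2 bd])
    finally show ?thesis
      by (simp add: A_def)
  qed
  have bnd: "A z = (LINT t|angle_measure. u (of_real r * cis t))" if z: "norm z = r" for z
  proof -
    have "z = of_real r * cis (Arg2pi z)"
      using Arg2pi_eq[of z] z by (simp add: cis_conv_exp)
    then have "A z = (LINT s|angle_measure. u (of_real r * cis (s + Arg2pi z)))"
      unfolding A_def by (metis (no_types, lifting) add.commute cis_mult mult.assoc)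
    also have "\<dots> = (LINT t|angle_measure. u (of_real r * cis t))"
    proof (rule integral_angle_shift)
      show "continuous_on UNIV (\<lambda>t. u (of_real r * cis t))"
        by (rule uc) (use r in \<open>auto intro!: continuous_intros simp: norm_mult\<close>)
      show "u (of_real r * cis (t + 2 * pi)) = u (of_real r * cis t)" for t
        by (simp add: cis_mult[symmetric] del: cis_mult)
    qed (use Arg2pi_ge_0 Arg2pi_lt_2pi in \<open>auto intro: less_imp_le\<close>)
    finally show ?thesis .
  qed
  \<comment> \<open>The error is the value of the strictly subharmonic perturbation on the outer
    circle; it vanishes as \<open>k\<close> tends to 0.\<close>
  have main: "u 0 \<le> (LINT t|angle_measure. u (of_real r * cis t)) + k * r\<^sup>2" if k: "0 < k" for k
  proof -
    have cB: "continuous_on (cball 0 r) (\<lambda>z. A z + k * (norm z)\<^sup>2)"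
      by (intro continuous_intros contA)
    obtain z where z: "norm z \<le> r" and max: "\<And>y. norm y \<le> r \<Longrightarrow> A y + k * (norm y)\<^sup>2 \<le> A z + k * (norm z)\<^sup>2"
      using continuous_attains_sup[OF compact_cball _ cB] r by (auto simp: Ball_def)
    have "norm z = r"
    proof (rule ccontr)
      assume "norm z \<noteq> r"
      then have lt: "norm z < r" using z by simp
      \<comment> \<open>This radius keeps the circle about an interior maximum inside the disc and
        below the locality threshold. The average of the perturbation over it exceeds the central
        value by \<open>k * d\<^sup>2\<close>, contradicting maximality.\<close>
      define d where "d = min (e / 2) (r - norm z)"
      have d: "0 < d" "d < e" "norm z + d \<le> r"
        using lt e by (auto simp: d_def)
      have le: "norm (z + of_real d * cis t) \<le> r" for t
        using norm_triangle_ineq[of z "of_real d * cis t"] d by (simp add: norm_mult)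
      define G where "G t = 2 * of_real d * cnj z * cis t" for t
      have sq: "(norm (z + of_real d * cis t))\<^sup>2 = (norm z)\<^sup>2 + d\<^sup>2 + Re (G t)" for t
      proof -
        have "d * (d * (cos t * cos t)) + d * (d * (sin t * sin t)) = d * d * ((cos t)\<^sup>2 + (sin t)\<^sup>2)"
          by (simp only: power2_eq_square algebra_simps)
        then have "d * (d * (cos t * cos t)) + d * (d * (sin t * sin t)) = d * d"
          by simp
        then show ?thesis
          unfolding cmod_power2 G_def by (simp add: power2_eq_square algebra_simps)
      qed
      have i1: "integrable angle_measure (\<lambda>t. A (z + of_real d * cis t))"
        by (rule integrable_angle, rule continuous_on_compose2[OF contA])
           (auto intro!: continuous_intros simp: le)
      have mv: "(LINT t|angle_measure. G t) = 0"
          "integrable angle_measure G"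
        using mean_value_circle[of "\<lambda>w. 2 * of_real d * cnj z * w"]
        unfolding G_def by (auto intro!: holomorphic_intros continuous_intros)
      have i2: "integrable angle_measure (\<lambda>t. k * (norm (z + of_real d * cis t))\<^sup>2)"
        by (rule integrable_angle) (auto intro!: continuous_intros)
      have "(LINT t|angle_measure. (norm (z + of_real d * cis t))\<^sup>2) = (norm z)\<^sup>2 + d\<^sup>2"
      proof -
        have "(LINT t|angle_measure. Re (G t)) = 0"
          using integral_Re[OF mv(2)] mv(1) by simp
        then show ?thesis
          unfolding sq using integrable_Re[OF mv(2)]
          by (subst Bochner_Integration.integral_add) (auto)
      qed
      then have "A z + k * ((norm z)\<^sup>2 + d\<^sup>2) \<le> (LINT t|angle_measure. A (z + of_real d * cis t) + k * (norm (z + of_real d * cis t))\<^sup>2)"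
        using subA[of z "of_real d"] d i1 i2 by simp
      also have "\<dots> \<le> (LINT t|angle_measure. A z + k * (norm z)\<^sup>2)"
        by (rule integral_mono) (use i1 i2 max le in auto)
      also have "\<dots> = A z + k * (norm z)\<^sup>2"
        by simp
      finally show False
        using mult_pos_pos[OF k, of "d\<^sup>2"] d by (simp add: algebra_simps)
    qed
    moreover have "A 0 = u 0"
      by (simp add: A_def)
    ultimately show ?thesis
      using max[of 0] r bnd[of z] by simp
  qed
  show ?thesis
  proof (rule field_le_epsilon)
    fix d :: real assume "0 < d"
    then show "u 0 \<le> (LINT t|angle_measure. u (of_real r * cis t)) + d"
      using main[of "d / r\<^sup>2"] r by simp
  qed
qed

section \<open>Homogeneity of the boundary distribution\<close>

text \<open>The real part of the barrier is harmonic for \<open>Re w > 0\<close>, negative for \<open>|w| > t\<close>, positive for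
  \<open>t/16 \<le> |w| \<le> t/8\<close> and at most \<open>34/t - 1/(4h)\<close> for \<open>|w| \<le> h\<close>. Cutting it off at 0 for
  \<open>|w| > t/8\<close> only therefore keeps it subharmonic, although it becomes very negative near 0.\<close>

definition barrier :: "real \<Rightarrow> real \<Rightarrow> complex \<Rightarrow> complex" where
  "barrier t h w = of_real (34 / t) * (1 - of_real (sqrt 2) * csqrt (w / of_real t)) - 1 / (of_real h + w)"

definition glued_barrier :: "real \<Rightarrow> real \<Rightarrow> complex \<Rightarrow> real" where
  "glued_barrier t h w = (if norm w \<le> t / 8 then Re (barrier t h w) else max 0 (Re (barrier t h w)))"

context
  fixes t h :: real
  assumes t: "0 < t" and h: "0 < h"
begin

text \<open>The factor \<open>sqrt 2\<close> cancels the denominator in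
  \<open>Re (csqrt z) = sqrt ((norm z + Re z) / 2)\<close>. For \<open>Re w > 0\<close> the sum
  \<open>norm w + Re w\<close> lies between \<open>norm w\<close> and \<open>2 * norm w\<close>, so
  this harmonic function is controlled by the modulus, which \<open>Re w\<close> is not.\<close>

lemma Re_barrier:
  "Re (barrier t h w) = 34 / t * (1 - sqrt ((norm w + Re w) / t)) - Re (1 / (of_real h + w))"
proof -
  have "sqrt 2 * Re (csqrt (w / of_real t)) = sqrt ((norm w + Re w) / t)"
    using t by (simp add: real_sqrt_mult[symmetric] norm_divide add_divide_distrib)
  moreover have "Re (barrier t h w) = 34 / t * (1 - sqrt 2 * Re (csqrt (w / of_real t))) - Re (1 / (of_real h + w))"
    unfolding barrier_def by (simp del: csqrt.simps)
  ultimately show ?thesis by simp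
qed

lemma holomorphic_barrier: "barrier t h holomorphic_on {w. 0 < Re w}"
proof -
  have "w / of_real t \<notin> \<real>\<^sub>\<le>\<^sub>0" if "0 < Re w" for w
    using that t by (auto simp: complex_nonpos_Reals_iff divide_le_0_iff)
  moreover have "of_real h + w \<noteq> 0" if "0 < Re w" for w
    using that h by (auto simp: complex_eq_iff)
  ultimately show ?thesis
    unfolding barrier_def using t by (auto intro!: holomorphic_intros)
qed

lemma Re_recip_pos: "0 < Re w \<Longrightarrow> 0 < Re (1 / (of_real h + w))"
  using h by (auto simp: Re_divide intro!: divide_pos_pos add_pos_nonneg)

lemma barrier_neg: "0 < Re w \<Longrightarrow> t < norm w \<Longrightarrow> Re (barrier t h w) < 0"
proof -
  assume w: "0 < Re w" "t < norm w"
  then have "1 < sqrt ((norm w + Re w) / t)"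
    using t by simp
  then have "34 / t * (1 - sqrt ((norm w + Re w) / t)) < 0"
    using t by (intro mult_pos_neg) auto
  then show ?thesis
    unfolding Re_barrier using Re_recip_pos[OF w(1)] by linarith
qed

lemma barrier_le: "0 < Re w \<Longrightarrow> Re (barrier t h w) \<le> 34 / t - Re (1 / (of_real h + w))"
proof -
  assume w: "0 < Re w"
  have "34 / t * (1 - sqrt ((norm w + Re w) / t)) \<le> 34 / t * 1"
    using t w by (intro mult_left_mono) auto
  then show ?thesis
    unfolding Re_barrier by simp
qed

text \<open>Origin of the constants: \<open>norm w \<le> t / 8\<close> makes the root at most 1/2,
  so the first term is at least \<open>17 / t\<close>, while \<open>t / 16 \<le> norm w\<close> caps
  the reciprocal by \<open>16 / t\<close>.\<close>

lemma barrier_nonneg: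
  assumes w: "0 < Re w" "t / 16 \<le> norm w" "norm w \<le> t / 8"
  shows "0 \<le> Re (barrier t h w)"
proof -
  have "(norm w + Re w) / t \<le> (1 / 2)\<^sup>2"
    using t w complex_Re_le_cmod[of w] by (simp add: field_simps power2_eq_square)
  then have "sqrt ((norm w + Re w) / t) \<le> 1 / 2"
    by (rule real_le_lsqrt[rotated 1]) auto
  then have "34 / t * (1 / 2) \<le> 34 / t * (1 - sqrt ((norm w + Re w) / t))"
    using t by (intro mult_left_mono) auto
  moreover have "Re (1 / (of_real h + w)) \<le> 16 / t"
  proof -
    have "(norm w)\<^sup>2 \<le> (norm (of_real h + w))\<^sup>2"
      unfolding cmod_power2 using w h by (auto intro!: power_mono)
    then have "norm w \<le> norm (of_real h + w)"
      by (simp add: power2_le_iff_abs_le)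
    moreover have "Re (1 / (of_real h + w)) \<le> norm (1 / (of_real h + w))"
      by (rule complex_Re_le_cmod)
    moreover have "1 / norm (of_real h + w) \<le> 1 / (t / 16)"
      by (rule frac_le) (use t w calculation in auto)
    ultimately show ?thesis
      by (simp add: norm_divide)
  qed
  ultimately show ?thesis
    unfolding Re_barrier using t by (simp add: field_simps)
qed

text \<open>The real part of \<open>1 / (h + w)\<close> is
  \<open>(h + Re w) / |h + w|\<^sup>2\<close>, with numerator at least \<open>h\<close> and modulus
  \<open>|h + w|\<close> at most \<open>2 * h\<close>.\<close>

lemma recip_ge:
  assumes w: "0 < Re w" "norm w \<le> h"
  shows "1 / (4 * h) \<le> Re (1 / (of_real h + w))"
proof -
  have "norm (of_real h + w) \<le> 2 * h"
    using norm_triangle_ineq[of "of_real h" w] w h by simp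
  then have "(norm (of_real h + w))\<^sup>2 \<le> (2 * h)\<^sup>2"
    by (intro power_mono) auto
  then have le: "(h + Re w)\<^sup>2 + (Im w)\<^sup>2 \<le> 4 * h\<^sup>2"
    unfolding cmod_power2 by (simp add: power_mult_distrib)
  have "h / (4 * h\<^sup>2) \<le> (h + Re w) / ((h + Re w)\<^sup>2 + (Im w)\<^sup>2)"
    by (rule frac_le) (use w h le in \<open>auto intro!: add_pos_nonneg\<close>)
  then show ?thesis
    using h by (simp add: Re_divide power2_eq_square)
qed

text \<open>The two branches agree on the annulus between \<open>t / 16\<close> and
  \<open>t / 8\<close>. This overlap lets a single formula hold near every point, which is what the
  local mean value inequality requires.\<close>

lemma glued_barrier_eq_max:
  "0 < Re w \<Longrightarrow> t / 16 \<le> norm w \<Longrightarrow> glued_barrier t h w = max 0 (Re (barrier t h w))"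
  using barrier_nonneg[of w] by (auto simp: glued_barrier_def)

lemma glued_barrier_eq_0: "0 < Re w \<Longrightarrow> t < norm w \<Longrightarrow> glued_barrier t h w = 0"
  using barrier_neg[of w] t by (simp add: glued_barrier_def)

lemma glued_barrier_le: "0 < Re w \<Longrightarrow> glued_barrier t h w \<le> 34 / t"
  using barrier_le[of w] Re_recip_pos[of w] t by (simp add: glued_barrier_def)

lemma glued_barrier_le':
  "0 < Re w \<Longrightarrow> norm w \<le> h \<Longrightarrow> 16 * h \<le> t \<Longrightarrow> glued_barrier t h w \<le> 34 / t - 1 / (4 * h)"
  using barrier_le[of w] recip_ge[of w] h by (simp add: glued_barrier_def)

lemma continuous_glued_barrier: "continuous_on {w. 0 < Re w} (glued_barrier t h)"
proof -
  have c: "continuous_on A (\<lambda>w. Re (barrier t h w))" if "A \<subseteq> {w. 0 < Re w}" for A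
    using holomorphic_on_imp_continuous_on[OF holomorphic_barrier] that
    by (intro continuous_intros) (rule continuous_on_subset)
  have "continuous_on {w. 0 < Re w} (\<lambda>w. if norm w \<le> t / 8 then Re (barrier t h w) else max 0 (Re (barrier t h w)))"
  proof (rule continuous_on_cases_le)
    show "Re (barrier t h w) = max 0 (Re (barrier t h w))" if "w \<in> {w. 0 < Re w}" "norm w = t / 8" for w
      using barrier_nonneg[of w] that t by simp
  qed (rule c continuous_on_max continuous_on_const continuous_on_norm continuous_on_id; auto)+
  then show ?thesis
    by (simp add: glued_barrier_def[abs_def])
qed

end

text \<open>The circle mean of the glued barrier of \<open>v\<close> is at least its value at the
  centre, which is 0 because \<open>t < norm (v 0)\<close>. So the loss of
  \<open>1 / (4 * h)\<close> on \<open>norm v \<le> h\<close> must be paid for by the at most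
  \<open>34 / t\<close> available on \<open>norm v \<le> t\<close>, and 136 is 4 times 34. The
  condition \<open>16 * h \<le> t\<close> puts \<open>norm v \<le> h\<close> into the region without
  cut-off.\<close>

lemma mass_homogeneity:
  assumes hol: "v holomorphic_on ball 0 1" and pos: "\<And>z. norm z < 1 \<Longrightarrow> 0 < Re (v z)"
    and r: "0 < r" "r < 1" and h: "0 < h" "16 * h \<le> t" and v0: "t < norm (v 0)"
  shows "measure angle_measure {s. norm (v (of_real r * cis s)) \<le> h}
    \<le> 136 * h / t * measure angle_measure {s. norm (v (of_real r * cis s)) \<le> t}"
proof -
  have t: "0 < t" using h by simp
  define u where "u z = glued_barrier t h (v z)" for z
  have contv: "continuous_on (ball 0 1) v"
    using hol by (rule holomorphic_on_imp_continuous_on)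
  have "uniformly_continuous_on (cball 0 r) v"
    by (rule compact_uniformly_continuous) (use r in \<open>auto intro!: continuous_on_subset[OF contv]\<close>)
  then obtain e where e: "0 < e"
    and uc: "\<And>x y. norm x \<le> r \<Longrightarrow> norm y \<le> r \<Longrightarrow> dist y x < e \<Longrightarrow> dist (v y) (v x) < t / 32"
    using t unfolding uniformly_continuous_on_def
    by (metis mem_cball_0 divide_pos_pos zero_less_numeral)
  have cont: "continuous_on (cball 0 r) u"
    unfolding u_def
    by (rule continuous_on_compose2[OF continuous_glued_barrier[OF t h(1)] continuous_on_subset[OF contv]])
       (use r pos in auto)
  have mean: "u 0 \<le> (LINT s|angle_measure. u (of_real r * cis s))"
  proof (rule le_circle_mean_of_local[OF r(1) cont e])
    fix x c :: complex
    assume c: "norm x + norm c \<le> r" "norm c < e"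
    have le: "norm (x + c * w) \<le> r" if "norm w \<le> 1" for w
      using norm_triangle_ineq[of x "c * w"] c mult_left_le[of "norm w" "norm c"] that by (simp add: norm_mult)
    have lt1: "norm (x + c * w) < 1" if "norm w \<le> 1" for w
      using le[OF that] r by linarith
    define G where "G w = barrier t h (v (x + c * w))" for w
    have cG: "continuous_on (cball 0 1) G"
      unfolding G_def
      by (rule continuous_on_compose2[OF holomorphic_on_imp_continuous_on[OF holomorphic_barrier[OF t h(1)]]],
          rule continuous_on_compose2[OF contv])
         (auto intro!: continuous_intros lt1 pos)
    have "((barrier t h \<circ> v) \<circ> (\<lambda>w. x + c * w)) holomorphic_on ball 0 1"
      by (rule holomorphic_on_compose_gen[OF _ holomorphic_on_compose_gen[OF hol holomorphic_barrier[OF t h(1)]]])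
         (auto intro!: holomorphic_intros lt1 pos)
    then have hG: "G holomorphic_on ball 0 1"
      by (simp add: G_def[abs_def] o_def)
    have mv: "(LINT s|angle_measure. Re (G (cis s))) = Re (G 0)" "integrable angle_measure (\<lambda>s. Re (G (cis s)))"
      using mean_value_circle[OF hG cG] by auto
    have near: "dist (v (x + c * cis s)) (v x) < t / 32" for s
      by (rule uc) (use le[of 0] le[of "cis s"] c in \<open>auto simp: dist_norm norm_mult\<close>)
    have n: "\<bar>norm (v (x + c * cis s)) - norm (v x)\<bar> < t / 32" for s
      using near[of s] norm_triangle_ineq3[of "v (x + c * cis s)" "v x"] by (simp add: dist_norm)
    have p: "0 < Re (v (x + c * cis s))" "0 < Re (v x)" for s
      using le[of "cis s"] le[of 0] r by (auto intro!: pos)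
    show "u x \<le> (LINT s|angle_measure. u (x + c * cis s))"
    \<comment> \<open>The threshold is the midpoint of \<open>t / 16\<close> and
      \<open>t / 8\<close>, and \<open>norm v\<close> varies by less than \<open>t / 32\<close> on
      the small circle. Hence the whole circle lies either where the barrier is uncut and harmonic,
      or where it is the maximum of 0 and a harmonic function.\<close>
    proof (cases "norm (v x) \<le> 3 * t / 32")
      case True
      have "u (x + c * cis s) = Re (G (cis s))" for s
        using n[of s] True t unfolding u_def G_def glued_barrier_def by auto
      moreover have "u x = Re (G 0)"
        using True t unfolding u_def G_def glued_barrier_def by auto
      ultimately show ?thesis
        using mv by simp
    next
      case False
      have eq: "u (x + c * cis s) = max 0 (Re (G (cis s)))" for s
        unfolding u_def G_def
        by (rule glued_barrier_eq_max[OF t h(1) p(1)]) (use n[of s] False t in linarith)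
      have "u x = max 0 (Re (G 0))"
        unfolding u_def G_def
        using glued_barrier_eq_max[OF t h(1) p(2)] False t by auto
      also have "\<dots> \<le> (LINT s|angle_measure. max 0 (Re (G (cis s))))"
      proof (rule max.boundedI)
        show "0 \<le> (LINT s|angle_measure. max 0 (Re (G (cis s))))"
          by (rule Bochner_Integration.integral_nonneg) auto
        show "Re (G 0) \<le> (LINT s|angle_measure. max 0 (Re (G (cis s))))"
          unfolding mv(1)[symmetric]
          by (rule integral_mono) (use mv in auto)
      qed
      finally show ?thesis
        by (simp add: eq)
    qed
  qed
  have "u 0 = 0"
    unfolding u_def using glued_barrier_eq_0[OF t h(1) pos v0] by simp
  define H where "H a = {s. norm (v (of_real r * cis s)) \<le> a}" for a
  have cv: "continuous_on UNIV (\<lambda>s. v (of_real r * cis s))"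
    by (rule continuous_on_compose2[OF contv]) (use r in \<open>auto intro!: continuous_intros simp: norm_mult\<close>)
  have H: "H a \<in> sets borel" for a
    unfolding H_def using cv by (intro borel_closed closed_Collect_le continuous_intros)
  have int: "integrable angle_measure (indicator (H a) :: real \<Rightarrow> real)" for a
    using H by (intro integrable_real_indicator) (auto simp: less_top[symmetric])
  have "(LINT s|angle_measure. u (of_real r * cis s)) \<le> (LINT s|angle_measure. 34 / t * indicator (H t) s - 1 / (4 * h) * indicator (H h) s)"
  proof (rule integral_mono)
    show "integrable angle_measure (\<lambda>s. u (of_real r * cis s))"
      by (rule integrable_angle, rule continuous_on_compose2[OF cont])
         (use r in \<open>auto intro!: continuous_intros simp: norm_mult\<close>)
    show "integrable angle_measure (\<lambda>s. 34 / t * indicator (H t) s - 1 / (4 * h) * indicator (H h) s)"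
      using int by simp
    show "u (of_real r * cis s) \<le> 34 / t * indicator (H t) s - 1 / (4 * h) * indicator (H h) s" for s
    proof -
      define w where "w = v (of_real r * cis s)"
      have w: "0 < Re w"
        unfolding w_def using r by (intro pos) (simp add: norm_mult)
      show ?thesis
        using glued_barrier_le[OF t h(1) w] glued_barrier_le'[OF t h(1) w] glued_barrier_eq_0[OF t h(1) w] h
        by (auto simp: u_def H_def w_def[symmetric] indicator_def)
    qed
  qed
  also have "\<dots> = 34 / t * measure angle_measure (H t) - 1 / (4 * h) * measure angle_measure (H h)"
    using int H by (simp add: measure_def)
  finally have "measure angle_measure (H h) / (4 * h) \<le> 34 / t * measure angle_measure (H t)"
    using mean \<open>u 0 = 0\<close> by simp
  then have "measure angle_measure (H h) \<le> 136 * h / t * measure angle_measure (H t)"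
    using h t by (simp add: field_simps)
  then show ?thesis
    by (simp add: H_def)
qed

section \<open>Taylor coefficients and circle means\<close>

lemma taylor_sums:
  assumes "g holomorphic_on ball 0 1" "norm z < 1"
  shows "(\<lambda>n. taylor_coeff g n * z ^ n) sums g z"
  using holomorphic_power_series[OF assms(1), of z] assms(2) by (simp add: taylor_coeff_def)

lemma integral_cis_power: "0 < n \<Longrightarrow> (LINT t|angle_measure. cis t ^ n) = 0"
  by (subst mean_value_circle(1)[of "\<lambda>w. w ^ n"]) (auto intro!: holomorphic_intros continuous_intros)

text \<open>Induction on the number of terms: the cross terms with the new top monomial have
  frequencies \<open>m - n > 0\<close>, so their means vanish.\<close>

lemma integral_norm_trig_poly:
  "(LINT t|angle_measure. (norm (\<Sum>n<m. c n * cis t ^ n))\<^sup>2) = (\<Sum>n<m. (norm (c n))\<^sup>2)"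
proof (induction m)
  case (Suc m)
  define P where "P t = (\<Sum>n<m. c n * cis t ^ n)" for t
  define Q where "Q t = 2 * (\<Sum>n<m. cnj (c n) * c m * cis t ^ (m - n))" for t
  have sq: "(norm (P t + c m * cis t ^ m))\<^sup>2 = (norm (P t))\<^sup>2 + (norm (c m))\<^sup>2 + Re (Q t)" for t
  proof -
    have "cnj (P t) * (c m * cis t ^ m) = (\<Sum>n<m. cnj (c n) * c m * cis t ^ (m - n))"
    proof -
      have "cnj (cis t) ^ n * cis t ^ m = cis t ^ (m - n)" if "n < m" for n
      proof -
        have "cis t ^ m = cis t ^ n * cis t ^ (m - n)"
          using that by (simp add: power_add[symmetric])
        then have "cnj (cis t) ^ n * cis t ^ m = (cnj (cis t) * cis t) ^ n * cis t ^ (m - n)"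
          by (simp add: power_mult_distrib)
        then show ?thesis
          by (simp add: cis_cnj cis_mult)
      qed
      then show ?thesis
        unfolding P_def cnj_sum sum_distrib_right
        by (intro sum.cong refl) (simp add: mult_ac)
    qed
    then have "Q t = 2 * (cnj (P t) * (c m * cis t ^ m))"
      by (simp add: Q_def)
    moreover have "(norm (a + b))\<^sup>2 = (norm a)\<^sup>2 + (norm b)\<^sup>2 + Re (2 * (cnj a * b))" for a b :: complex
      unfolding cmod_power2 by (simp add: power2_eq_square algebra_simps)
    ultimately show ?thesis
      by (simp add: norm_mult norm_power)
  qed
  have iQ: "integrable angle_measure (\<lambda>t. cnj (c n) * c m * cis t ^ (m - n))" for n
    by (rule integrable_angle) (auto intro!: continuous_intros)
  have Q: "(LINT t|angle_measure. Q t) = 0" "integrable angle_measure Q"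
    unfolding Q_def using iQ
    by (auto simp: integral_cis_power)
  have iP: "integrable angle_measure (\<lambda>t. (norm (P t))\<^sup>2)"
    unfolding P_def by (rule integrable_angle) (auto intro!: continuous_intros)
  have "(LINT t|angle_measure. Re (Q t)) = 0"
    using integral_Re[OF Q(2)] Q(1) by simp
  then have "(LINT t|angle_measure. (norm (P t + c m * cis t ^ m))\<^sup>2) = (LINT t|angle_measure. (norm (P t))\<^sup>2) + (norm (c m))\<^sup>2"
    unfolding sq using iP integrable_Re[OF Q(2)] by simp
  with Suc show ?case
    by (simp add: P_def)
qed simp

text \<open>Inside the disc the series converges absolutely, so the partial sums are uniformly
  bounded on the circle and dominated convergence extends the identity from trigonometric
  polynomials.\<close>

lemma parseval_sums:
  assumes hol: "g holomorphic_on ball 0 1" and r: "0 \<le> r" "r < 1"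
  shows "(\<lambda>n. (norm (taylor_coeff g n * of_real r ^ n))\<^sup>2) sums (LINT t|angle_measure. (norm (g (of_real r * cis t)))\<^sup>2)"
proof -
  define c where "c n = taylor_coeff g n * of_real r ^ n" for n
  have "summable (\<lambda>n. norm (c n))"
  proof -
    obtain R where R: "r < R" "R < 1" using r dense by blast
    have "summable (\<lambda>n. taylor_coeff g n * of_real R ^ n)"
      by (rule sums_summable[OF taylor_sums[OF hol]]) (use R r in auto)
    then show ?thesis
      unfolding c_def by (rule powser_insidea) (use R r in auto)
  qed
  then have bd: "norm (\<Sum>n<m. c n * cis t ^ n) \<le> (\<Sum>n. norm (c n))" for m t
  proof -
    assume s: "summable (\<lambda>n. norm (c n))"
    have "norm (\<Sum>n<m. c n * cis t ^ n) \<le> (\<Sum>n<m. norm (c n * cis t ^ n))"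
      by (rule norm_sum)
    also have "\<dots> = (\<Sum>n<m. norm (c n))"
      by (simp add: norm_mult norm_power)
    also have "\<dots> \<le> (\<Sum>n. norm (c n))"
      by (rule sum_le_suminf[OF s]) auto
    finally show ?thesis .
  qed
  have lim: "(\<lambda>m. \<Sum>n<m. c n * cis t ^ n) \<longlonglongrightarrow> g (of_real r * cis t)" for t
    using taylor_sums[OF hol, of "of_real r * cis t"] r
    by (simp add: sums_def c_def norm_mult power_mult_distrib mult.assoc)
  have "(\<lambda>m. LINT t|angle_measure. (norm (\<Sum>n<m. c n * cis t ^ n))\<^sup>2) \<longlonglongrightarrow> (LINT t|angle_measure. (norm (g (of_real r * cis t)))\<^sup>2)"
  proof (rule integral_dominated_convergence[where w = "\<lambda>_. (\<Sum>n. norm (c n))\<^sup>2"])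
    show "(\<lambda>t. (norm (g (of_real r * cis t)))\<^sup>2) \<in> borel_measurable angle_measure"
    proof -
      have "continuous_on UNIV (\<lambda>t. g (of_real r * cis t))"
        by (rule continuous_on_compose2[OF holomorphic_on_imp_continuous_on[OF hol]])
           (use r in \<open>auto intro!: continuous_intros simp: norm_mult\<close>)
      then show ?thesis
        by (intro borel_measurable_integrable integrable_angle continuous_intros)
    qed
    show "(\<lambda>t. (norm (\<Sum>n<m. c n * cis t ^ n))\<^sup>2) \<in> borel_measurable angle_measure" for m
      by (intro borel_measurable_integrable integrable_angle) (auto intro!: continuous_intros)
    show "AE t in angle_measure. (\<lambda>m. (norm (\<Sum>n<m. c n * cis t ^ n))\<^sup>2) \<longlonglongrightarrow> (norm (g (of_real r * cis t)))\<^sup>2"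
      by (intro AE_I2 tendsto_intros lim)
    show "AE t in angle_measure. norm ((norm (\<Sum>n<m. c n * cis t ^ n))\<^sup>2) \<le> (\<Sum>n. norm (c n))\<^sup>2" for m
      using bd by (auto intro!: power_mono)
  qed auto
  then show ?thesis
    unfolding integral_norm_trig_poly by (simp add: sums_def c_def)
qed

text \<open>By Parseval every partial sum with weights \<open>r ^ n\<close> is at most
  \<open>B\<^sup>2\<close>, and \<open>r\<close> tends to 1. It serves for compositions of \<phi>
  with combinations of kernels, which are bounded on the disc.\<close>

lemma summable_taylor_coeff_bounded:
  assumes hol: "g holomorphic_on ball 0 1" and bd: "\<And>z. norm z < 1 \<Longrightarrow> norm (g z) \<le> B"
  shows "summable (\<lambda>n. (norm (taylor_coeff g n))\<^sup>2)"
proof (rule summableI_nonneg_bounded)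
  have B: "0 \<le> B" using bd[of 0] order_trans[OF norm_ge_zero] by fastforce
  fix m
  have "(\<Sum>n<m. (norm (taylor_coeff g n * of_real r ^ n))\<^sup>2) \<le> B\<^sup>2" if r: "0 < r" "r < 1" for r :: real
  proof -
    have "(\<Sum>n<m. (norm (taylor_coeff g n * of_real r ^ n))\<^sup>2) \<le> (LINT t|angle_measure. (norm (g (of_real r * cis t)))\<^sup>2)"
      using parseval_sums[OF hol, of r] r
      by (metis (no_types, lifting) less_imp_le sum_le_suminf sums_iff finite_lessThan zero_le_power2)
    also have "\<dots> \<le> (LINT t|angle_measure. B\<^sup>2)"
    proof (rule integral_mono)
      have "continuous_on UNIV (\<lambda>t. g (of_real r * cis t))"
        by (rule continuous_on_compose2[OF holomorphic_on_imp_continuous_on[OF hol]])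
           (use r in \<open>auto intro!: continuous_intros simp: norm_mult\<close>)
      then show "integrable angle_measure (\<lambda>t. (norm (g (of_real r * cis t)))\<^sup>2)"
        by (intro integrable_angle continuous_intros)
      show "(norm (g (of_real r * cis t)))\<^sup>2 \<le> B\<^sup>2" for t
        using r by (intro power_mono bd) (auto simp: norm_mult)
    qed auto
    also have "\<dots> = B\<^sup>2"
      by simp
    finally show ?thesis .
  qed
  then have "eventually (\<lambda>r. (\<Sum>n<m. (norm (taylor_coeff g n * of_real r ^ n))\<^sup>2) \<le> B\<^sup>2) (at_left (1::real))"
    using eventually_at_left_real[of 0 1] by (auto elim!: eventually_mono)
  moreover have "((\<lambda>r::real. \<Sum>n<m. (norm (taylor_coeff g n * of_real r ^ n))\<^sup>2) \<longlongrightarrow> (\<Sum>n<m. (norm (taylor_coeff g n * of_real 1 ^ n))\<^sup>2)) (at_left 1)"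
    by (intro tendsto_intros)
  ultimately show "(\<Sum>n<m. (norm (taylor_coeff g n))\<^sup>2) \<le> B\<^sup>2"
    using tendsto_upperbound by (force simp: trivial_limit_at_left_real)
qed auto

text \<open>Square-summable coefficients are bounded, so their power series converges on the disc.
  This produces elements of the Hardy space from coefficients, in particular the values of the
  adjoint and the reproducing kernels.\<close>

lemma exists_hardy2_of_coeffs:
  assumes b: "summable (\<lambda>n. (norm (b n))\<^sup>2)"
  obtains f where "\<And>n. hcoeff f n = b n" "\<And>z. norm z < 1 \<Longrightarrow> (\<lambda>n. b n * z ^ n) sums hardy_fun f z"
proof -
  define F where "F = Abs_fps b"
  have sum: "summable (\<lambda>n. b n * z ^ n)" if z: "norm z < 1" for z
  proof -
    have "(\<lambda>n. (norm (b n))\<^sup>2) \<longlonglongrightarrow> 0"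
      using b by (rule summable_LIMSEQ_zero)
    then have "(\<lambda>n. sqrt ((norm (b n))\<^sup>2)) \<longlonglongrightarrow> sqrt 0"
      by (rule tendsto_real_sqrt)
    then have "(\<lambda>n. b n) \<longlonglongrightarrow> 0"
      by (simp add: tendsto_norm_zero_iff)
    then have "Bseq b"
      by (rule convergent_imp_Bseq[OF convergentI])
    then obtain K where K: "\<And>n. norm (b n) \<le> K"
      unfolding Bseq_def by auto
    have "summable (\<lambda>n. K * norm z ^ n)"
      using z by (intro summable_mult summable_geometric) auto
    then show ?thesis
      by (rule summable_comparison_test'[where N = 0])
         (use K in \<open>auto simp: norm_mult norm_power intro!: mult_right_mono\<close>)
  qed
  have "1 \<le> fps_conv_radius F"
    unfolding fps_conv_radius_def
    by (rule conv_radius_geI_ex') (use sum in \<open>auto simp: F_def\<close>)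
  then have sub: "ball 0 1 \<subseteq> eball 0 (fps_conv_radius F)"
    by (intro ball_eball_mono) (simp add: one_ereal_def)
  have hol: "eval_fps F holomorphic_on ball 0 1"
    by (rule holomorphic_on_eval_fps[OF sub])
  define g where "g z = (if z \<in> ball 0 1 then eval_fps F z else 0)" for z
  have hol': "g holomorphic_on ball 0 1"
    by (rule holomorphic_transform[OF hol]) (simp add: g_def)
  have tc: "taylor_coeff g n = b n" for n
  proof -
    have "(deriv ^^ n) g 0 = (deriv ^^ n) (eval_fps F) 0"
      by (rule higher_deriv_transform_within_open[OF hol' hol]) (auto simp: g_def)
    moreover have "0 < fps_conv_radius F"
      using \<open>1 \<le> fps_conv_radius F\<close> by (rule order.strict_trans2[rotated]) simp
    ultimately show ?thesis
      using fps_nth_conv_deriv[of F n] by (simp add: taylor_coeff_def F_def)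
  qed
  have g: "g \<in> hardy2_set"
    using hol' b by (auto simp: hardy2_set_def tc) (auto simp: g_def)
  show thesis
  proof (rule that[of "Abs_hardy2 g"])
    show "hcoeff (Abs_hardy2 g) n = b n" for n
      by (simp add: Abs_hardy2_inverse g tc)
    show "(\<lambda>n. b n * z ^ n) sums hardy_fun (Abs_hardy2 g) z" if "norm z < 1" for z
      using summable_sums[OF sum[OF that]] that
      by (simp add: Abs_hardy2_inverse g) (simp add: g_def eval_fps_def F_def)
  qed
qed

lemma hardy2_norm_ge_circle_mean:
  assumes "0 \<le> r" "r < 1"
  shows "(LINT t|angle_measure. (norm (hardy_fun f (of_real r * cis t)))\<^sup>2) \<le> (norm f)\<^sup>2"
proof -
  have "(LINT t|angle_measure. (norm (hardy_fun f (of_real r * cis t)))\<^sup>2) = (\<Sum>n. (norm (hcoeff f n * of_real r ^ n))\<^sup>2)"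
    using parseval_sums[OF hardy_fun_holomorphic assms] by (simp add: sums_iff)
  also have "\<dots> \<le> (\<Sum>n. (norm (hcoeff f n))\<^sup>2)"
  proof (rule suminf_le)
    show "(norm (hcoeff f n * of_real r ^ n))\<^sup>2 \<le> (norm (hcoeff f n))\<^sup>2" for n
      using assms by (intro power_mono) (auto simp: norm_mult norm_power intro!: mult_left_le power_le_one)
    show "summable (\<lambda>n. (norm (hcoeff f n * of_real r ^ n))\<^sup>2)"
      using parseval_sums[OF hardy_fun_holomorphic assms] by (rule sums_summable)
  qed (rule summable_hcoeff)
  also have "\<dots> = (norm f)\<^sup>2"
    by (simp add: power2_norm_eq_inner inner_hardy2_self)
  finally show ?thesis .
qed

section \<open>Operators on the Hardy space\<close>

interpretation hardy: vector_space hscale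
  by (rule vector_space_hscale)

interpretation hardy_pair: vector_space_pair hscale hscale ..

text \<open>Multiplicities are complex dimensions, so orthogonality has to be taken in the Hermitian
  sense; \<open>inner\<close> only provides the real part.\<close>

definition cinner :: "hardy2 \<Rightarrow> hardy2 \<Rightarrow> complex" where
  "cinner f g = (\<Sum>n. hcoeff f n * cnj (hcoeff g n))"

lemma Re_cinner: "Re (cinner f g) = f \<bullet> g"
  by (simp add: cinner_def inner_hardy2_def)

lemma cinner_sums: "(\<lambda>n. hcoeff f n * cnj (hcoeff g n)) sums cinner f g"
  unfolding cinner_def by (rule summable_sums[OF summable_hcoeff_mult])

lemma cinner_add_left: "cinner (f + g) h = cinner f h + cinner g h"
  using sums_add[OF cinner_sums[of f h] cinner_sums[of g h]] cinner_sums[of "f + g" h]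
  by (simp add: hcoeff_add distrib_right sums_unique2)

lemma cinner_hscale_left: "cinner (hscale c f) g = c * cinner f g"
  using sums_mult[OF cinner_sums[of f g], of c] cinner_sums[of "hscale c f" g]
  by (simp add: hcoeff_hscale mult.assoc sums_unique2)

lemma cnj_cinner: "cnj (cinner f g) = cinner g f"
proof -
  have "(\<lambda>n. cnj (hcoeff f n * cnj (hcoeff g n))) sums cnj (cinner f g)"
    using cinner_sums[of f g] by (simp only: sums_cnj)
  then show ?thesis
    using cinner_sums[of g f] by (simp add: mult.commute sums_unique2)
qed

lemma cinner_hscale_right: "cinner f (hscale c g) = cnj c * cinner f g"
  by (metis cinner_hscale_left cnj_cinner complex_cnj_mult)

lemma cinner_zero_left [simp]: "cinner 0 g = 0"
  using cinner_hscale_left[of 0 0 g] by simp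

lemma cinner_diff_left: "cinner (f - g) h = cinner f h - cinner g h"
  using cinner_add_left[of "f - g" g h] by simp

lemma cinner_sum_left: "cinner (sum f A) g = (\<Sum>x\<in>A. cinner (f x) g)"
  by (induction A rule: infinite_finite_induct) (auto simp: cinner_add_left)

lemma cinner_sum_right: "cinner g (sum f A) = (\<Sum>x\<in>A. cinner g (f x))"
  by (simp only: cnj_cinner[symmetric, of g] cinner_sum_left cnj_sum)

lemma cinner_self: "cinner f f = of_real ((norm f)\<^sup>2)"
proof (rule complex_eqI)
  show "Re (cinner f f) = Re (of_real ((norm f)\<^sup>2))"
    by (simp add: Re_cinner power2_norm_eq_inner)
  show "Im (cinner f f) = Im (of_real ((norm f)\<^sup>2))"
    using cnj_cinner[of f f] by (simp add: complex_eq_iff)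
qed

lemma scaleR_hardy2: "r *\<^sub>R f = hscale (of_real r) (f :: hardy2)"
  by (simp add: scaleR_hardy2_def)

lemma hscale_scaleR: "hscale c (r *\<^sub>R f) = r *\<^sub>R hscale c f"
  by (simp add: scaleR_hardy2 mult.commute)

lemma norm_hscale: "norm (hscale c f) = cmod c * norm f"
proof -
  have "cinner (hscale c f) (hscale c f) = c * cnj c * cinner f f"
    by (simp add: cinner_hscale_left cinner_hscale_right)
  then have "(of_real ((norm (hscale c f))\<^sup>2) :: complex) = of_real ((cmod c * norm f)\<^sup>2)"
    by (simp only: cinner_self complex_norm_square[symmetric] of_real_mult[symmetric] power_mult_distrib)
  then have "(norm (hscale c f))\<^sup>2 = (cmod c * norm f)\<^sup>2"
    using of_real_eq_iff by blast
  then show ?thesis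
    by (simp add: power2_eq_iff_nonneg)
qed

lemma inner_hscale_left: "hscale c f \<bullet> g = f \<bullet> hscale (cnj c) g"
  by (simp add: Re_cinner[symmetric] cinner_hscale_left cinner_hscale_right)

lemma cinner_eq_Complex: "cinner f g = Complex (f \<bullet> g) (f \<bullet> hscale \<i> g)"
  by (rule complex_eqI) (simp_all add: Re_cinner[symmetric] cinner_hscale_right)

lemma hcoeff_sum: "hcoeff (sum f A) n = (\<Sum>x\<in>A. hcoeff (f x) n)"
proof -
  have "hcoeff 0 n = 0"
    using hcoeff_hscale[of 0 0 n] by simp
  then show ?thesis
    by (induction A rule: infinite_finite_induct) (auto simp: hcoeff_add)
qed

lemma hcoeff_diff: "hcoeff (f - g) n = hcoeff f n - hcoeff g n"
  using hcoeff_add[of "f - g" g n] by simp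

definition of_coeffs :: "(nat \<Rightarrow> complex) \<Rightarrow> hardy2" where
  "of_coeffs b = (SOME f. \<forall>n. hcoeff f n = b n)"

lemma hcoeff_of_coeffs: "summable (\<lambda>n. (norm (b n))\<^sup>2) \<Longrightarrow> hcoeff (of_coeffs b) n = b n"
  unfolding of_coeffs_def by (rule someI2_ex) (auto elim!: exists_hardy2_of_coeffs)

definition monomial :: "nat \<Rightarrow> hardy2" where
  "monomial n = of_coeffs (\<lambda>k. if k = n then 1 else 0)"

lemma hcoeff_monomial: "hcoeff (monomial n) k = (if k = n then 1 else 0)"
  unfolding monomial_def
  by (subst hcoeff_of_coeffs) (auto intro!: summable_finite[of "{n}"] split: if_splits)

lemma hcoeff_monomial_sum:
  "hcoeff (\<Sum>n<m. hscale (c n) (monomial n)) k = (if k < m then c k else 0)"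
proof -
  have "(\<Sum>n<m. c n * (if k = n then 1 else 0)) = (\<Sum>n<m. if k = n then c n else 0)"
    by (intro sum.cong) auto
  then show ?thesis
    by (simp add: hcoeff_sum hcoeff_hscale hcoeff_monomial)
qed

lemma norm_hardy2_sq: "(norm f)\<^sup>2 = (\<Sum>n. (cmod (hcoeff f n))\<^sup>2)"
  by (simp add: power2_norm_eq_inner inner_hardy2_self)

lemma monomial_expansion:
  "(\<lambda>m. \<Sum>n<m. hscale (hcoeff f n) (monomial n)) \<longlonglongrightarrow> f"
proof -
  define P where "P m = (\<Sum>n<m. hscale (hcoeff f n) (monomial n))" for m
  have "(norm (P m - f))\<^sup>2 = (norm f)\<^sup>2 - (\<Sum>n<m. (cmod (hcoeff f n))\<^sup>2)" for m
  proof -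
    have "(\<lambda>n. (cmod (hcoeff (P m - f) n))\<^sup>2) = (\<lambda>n. (cmod (hcoeff f n))\<^sup>2 - (if n \<in> {..<m} then (cmod (hcoeff f n))\<^sup>2 else 0))"
      by (auto simp: fun_eq_iff hcoeff_diff P_def hcoeff_monomial_sum)
    moreover have "\<dots> sums ((norm f)\<^sup>2 - (\<Sum>n<m. (cmod (hcoeff f n))\<^sup>2))"
      by (intro sums_diff sums_If_finite_set) (simp_all add: norm_hardy2_sq summable_sums[OF summable_hcoeff])
    ultimately show ?thesis
      unfolding norm_hardy2_sq[of "P m - f"] by (simp add: sums_iff)
  qed
  moreover have "(\<lambda>m. (norm f)\<^sup>2 - (\<Sum>n<m. (cmod (hcoeff f n))\<^sup>2)) \<longlonglongrightarrow> (norm f)\<^sup>2 - (norm f)\<^sup>2"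
    unfolding norm_hardy2_sq[of f] by (intro tendsto_intros summable_LIMSEQ summable_hcoeff)
  ultimately have "(\<lambda>m. sqrt ((norm (P m - f))\<^sup>2)) \<longlonglongrightarrow> sqrt 0"
    by (intro tendsto_real_sqrt) simp
  then have "(\<lambda>m. P m - f) \<longlonglongrightarrow> 0"
    by (simp add: tendsto_norm_zero_iff)
  then show ?thesis
    by (simp add: LIM_zero_iff P_def)
qed

section \<open>Bounded operators and their adjoints\<close>

locale bounded_hardy_operator =
  fixes T :: "hardy2 \<Rightarrow> hardy2" and K :: real
  assumes linear: "Vector_Spaces.linear hscale hscale T"
    and bound: "norm (T f) \<le> K * norm f"
    and K_nonneg: "0 \<le> K"
begin

sublocale T: Vector_Spaces.linear hscale hscale T
  by (rule linear)

lemma T_scaleR: "T (r *\<^sub>R f) = r *\<^sub>R T f"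
  by (simp add: scaleR_hardy2 T.scale)

lemma tendsto_T: "(f \<longlongrightarrow> a) F \<Longrightarrow> ((\<lambda>x. T (f x)) \<longlongrightarrow> T a) F"
proof -
  assume "(f \<longlongrightarrow> a) F"
  then have "((\<lambda>x. K * norm (f x - a)) \<longlongrightarrow> K * norm (a - a)) F"
    by (intro tendsto_mult tendsto_const tendsto_norm tendsto_diff)
  then have lim: "((\<lambda>x. K * norm (f x - a)) \<longlongrightarrow> 0) F"
    by (simp only: diff_self norm_zero mult_zero_right)
  have le: "norm (T (f x) - T a) \<le> K * norm (f x - a)" for x
    unfolding T.diff[symmetric] by (rule bound)
  have "((\<lambda>x. T (f x) - T a) \<longlongrightarrow> 0) F"
    by (rule Lim_null_comparison[OF always_eventually lim]) (use le in blast)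
  then show ?thesis
    by (rule LIM_zero_cancel)
qed

text \<open>Since \<open>adjoint\<close> is a choice, some operator with the adjoint property has to
  be exhibited. The image of \<open>g\<close> is built from its only possible coefficients,
  \<open>cinner g (T (monomial n))\<close>.\<close>

lemma inner_adjoint: "T f \<bullet> g = f \<bullet> adjoint T g"
proof -
  have "\<exists>S. \<forall>f g. T f \<bullet> g = f \<bullet> S g"
  proof (intro exI allI)
    fix f g
    define b where "b g n = cinner g (T (monomial n))" for g n
    have "summable (\<lambda>n. (norm (b g n))\<^sup>2)"
    proof (rule summableI_nonneg_bounded)
      fix m
      \<comment> \<open>The test vector is the truncation of the sought element: both its squared
        norm and the pairing of \<open>g\<close> with \<open>T p\<close> equal the partial sum
        \<open>s\<close>, so boundedness of \<open>T\<close> gives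
        \<open>s \<le> norm g * K * sqrt s\<close>.\<close>
      define p where "p = (\<Sum>n<m. hscale (b g n) (monomial n))"
      define s where "s = (\<Sum>n<m. (norm (b g n))\<^sup>2)"
      have "cinner g (T p) = of_real s"
        by (simp only: p_def T.sum T.scale cinner_sum_right cinner_hscale_right b_def[symmetric] s_def
            complex_norm_square mult.commute of_real_sum)
      then have "s = g \<bullet> T p"
        by (simp add: Re_cinner[symmetric])
      also have "\<dots> \<le> norm g * norm (T p)"
        by (rule norm_cauchy_schwarz)
      also have "\<dots> \<le> norm g * (K * norm p)"
        by (intro mult_left_mono bound) auto
      finally have s: "s \<le> norm g * K * norm p"
        by simp
      have "(norm p)\<^sup>2 = s"
      proof -
        have "(\<lambda>n. (cmod (hcoeff p n))\<^sup>2) = (\<lambda>n. if n \<in> {..<m} then (norm (b g n))\<^sup>2 else 0)"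
          by (auto simp: fun_eq_iff p_def hcoeff_monomial_sum)
        moreover have "\<dots> sums s"
          unfolding s_def by (rule sums_If_finite_set) simp
        ultimately show ?thesis
          by (simp add: norm_hardy2_sq sums_iff)
      qed
      then have "norm p * norm p \<le> (norm g * K) * norm p"
        using s by (simp add: power2_eq_square)
      then have "norm p \<le> norm g * K"
        using K_nonneg by (cases "norm p = 0") (auto simp del: norm_eq_zero simp: mult_le_cancel_right)
      then have "(norm p)\<^sup>2 \<le> (norm g * K)\<^sup>2"
        by (intro power_mono) auto
      then show "(\<Sum>n<m. (norm (b g n))\<^sup>2) \<le> (norm g * K)\<^sup>2"
        using \<open>(norm p)\<^sup>2 = s\<close> by (simp add: s_def)
    qed auto
    then have co: "hcoeff (of_coeffs (b g)) n = b g n" for n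
      by (rule hcoeff_of_coeffs)
    have lim1: "(\<lambda>m. T (\<Sum>n<m. hscale (hcoeff f n) (monomial n)) \<bullet> g) \<longlonglongrightarrow> T f \<bullet> g"
      by (rule tendsto_inner[OF tendsto_T[OF monomial_expansion] tendsto_const])
    have eq: "T (\<Sum>n<m. hscale (hcoeff f n) (monomial n)) \<bullet> g = Re (\<Sum>n<m. hcoeff f n * cnj (hcoeff (of_coeffs (b g)) n))" for m
      by (simp only: Re_cinner[symmetric] T.sum T.scale cinner_sum_left cinner_hscale_left co b_def cnj_cinner)
    have lim2: "(\<lambda>m. Re (\<Sum>n<m. hcoeff f n * cnj (hcoeff (of_coeffs (b g)) n))) \<longlonglongrightarrow> Re (cinner f (of_coeffs (b g)))"
      by (rule tendsto_Re) (use cinner_sums in \<open>simp only: sums_def\<close>)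
    have "T f \<bullet> g = f \<bullet> of_coeffs (b g)"
      using LIMSEQ_unique[OF lim1[unfolded eq] lim2] by (simp only: Re_cinner)
    then show "T f \<bullet> g = f \<bullet> of_coeffs (\<lambda>n. cinner g (T (monomial n)))"
      by (simp only: b_def[abs_def])
  qed
  then show ?thesis
    by (metis adjoint_unique)
qed

definition A :: "hardy2 \<Rightarrow> hardy2" where
  "A f = adjoint T (T f)"

lemma inner_A: "f \<bullet> A g = T f \<bullet> T g"
  by (simp add: A_def inner_adjoint)

lemma inner_A': "A f \<bullet> g = T f \<bullet> T g"
  by (subst inner_commute) (simp only: inner_A inner_commute)

lemma A_add: "A (f + g) = A f + A g"
  by (rule vector_eq_ldot[THEN iffD1], rule allI) (simp only: inner_A T.add inner_add_right)

lemma A_hscale: "A (hscale c f) = hscale c (A f)"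
proof -
  have "x \<bullet> A (hscale c f) = x \<bullet> hscale c (A f)" for x
  proof -
    have "x \<bullet> A (hscale c f) = T x \<bullet> hscale c (T f)"
      by (simp only: inner_A T.scale)
    also have "\<dots> = hscale (cnj c) (T x) \<bullet> T f"
      by (simp only: inner_hscale_left complex_cnj_cnj)
    also have "\<dots> = hscale (cnj c) x \<bullet> A f"
      by (simp only: inner_A T.scale)
    also have "\<dots> = x \<bullet> hscale c (A f)"
      by (simp only: inner_hscale_left complex_cnj_cnj)
    finally show ?thesis .
  qed
  then show ?thesis
    by (intro vector_eq_ldot[THEN iffD1]) (rule allI)
qed

lemma norm_adjoint_le: "norm (adjoint T y) \<le> K * norm y"
proof -
  have "norm (adjoint T y) * norm (adjoint T y) = T (adjoint T y) \<bullet> y"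
    by (simp add: inner_adjoint power2_norm_eq_inner[symmetric] power2_eq_square)
  also have "\<dots> \<le> norm (T (adjoint T y)) * norm y"
    by (rule norm_cauchy_schwarz)
  also have "\<dots> \<le> K * norm (adjoint T y) * norm y"
    by (intro mult_right_mono bound) auto
  finally have "norm (adjoint T y) * norm (adjoint T y) \<le> (K * norm y) * norm (adjoint T y)"
    by (simp add: mult_ac)
  then show ?thesis
    using K_nonneg by (cases "norm (adjoint T y) = 0") (auto simp del: norm_eq_zero simp: mult_le_cancel_right)
qed

lemma adjoint_diff: "adjoint T (y - z) = adjoint T y - adjoint T z"
  by (rule vector_eq_ldot[THEN iffD1], rule allI) (simp only: inner_adjoint[symmetric] inner_diff_right)

lemma tendsto_adjoint: "(f \<longlongrightarrow> a) F \<Longrightarrow> ((\<lambda>x. adjoint T (f x)) \<longlongrightarrow> adjoint T a) F"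
proof -
  assume "(f \<longlongrightarrow> a) F"
  then have "((\<lambda>x. K * norm (f x - a)) \<longlongrightarrow> K * norm (a - a)) F"
    by (intro tendsto_mult tendsto_const tendsto_norm tendsto_diff)
  then have lim: "((\<lambda>x. K * norm (f x - a)) \<longlongrightarrow> 0) F"
    by (simp only: diff_self norm_zero mult_zero_right)
  have le: "norm (adjoint T (f x) - adjoint T a) \<le> K * norm (f x - a)" for x
    unfolding adjoint_diff[symmetric] by (rule norm_adjoint_le)
  have "((\<lambda>x. adjoint T (f x) - adjoint T a) \<longlongrightarrow> 0) F"
    by (rule Lim_null_comparison[OF always_eventually lim]) (use le in blast)
  then show ?thesis
    by (rule LIM_zero_cancel)
qed

end

section \<open>Lower bounds for singular numbers\<close>

lemma compact_operator_bounded: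
  assumes "compact_operator T"
  obtains K where "bounded_hardy_operator T K"
proof -
  have lin: "Vector_Spaces.linear hscale hscale T" and comp: "compact (closure (T ` cball 0 1))"
    using assms by (auto simp: compact_operator_def)
  interpret T: Vector_Spaces.linear hscale hscale T by (rule lin)
  have "bounded (T ` cball 0 1)"
    using compact_imp_bounded[OF comp] bounded_subset closure_subset by blast
  then obtain K where K: "\<And>f. norm f \<le> 1 \<Longrightarrow> norm (T f) \<le> K"
    by (force simp: bounded_iff)
  have bound: "norm (T f) \<le> K * norm f" for f
  proof (cases "f = 0")
    case False
    have "T f = norm f *\<^sub>R T (inverse (norm f) *\<^sub>R f)"
      using False by (simp add: scaleR_hardy2 T.scale)
    then have "norm (T f) = norm f * norm (T (inverse (norm f) *\<^sub>R f))"
      by (metis abs_norm_cancel norm_scaleR)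
    also have "\<dots> \<le> norm f * K"
      using False by (intro mult_left_mono K) auto
    finally show ?thesis
      by (simp add: mult.commute)
  qed (simp add: T.zero)
  have "0 \<le> K"
    using K[of 0] by (simp add: T.zero)
  then have "bounded_hardy_operator T K"
    by unfold_locales (use lin bound in \<open>auto simp: Vector_Spaces.linear_iff\<close>)
  then show thesis by (rule that)
qed

section \<open>Finite orthonormal systems and eigenspaces\<close>

definition orthonormal :: "hardy2 set \<Rightarrow> bool" where
  "orthonormal O' \<longleftrightarrow> (\<forall>e\<in>O'. norm e = 1) \<and> (\<forall>e\<in>O'. \<forall>e'\<in>O'. e \<noteq> e' \<longrightarrow> cinner e e' = 0)"

lemma orthonormal_cinner:
  "orthonormal O' \<Longrightarrow> e \<in> O' \<Longrightarrow> e' \<in> O' \<Longrightarrow> cinner e e' = (if e = e' then 1 else 0)"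
  by (auto simp: orthonormal_def cinner_self)

definition proj :: "hardy2 set \<Rightarrow> hardy2 \<Rightarrow> hardy2" where
  "proj O' f = (\<Sum>e\<in>O'. hscale (cinner f e) e)"

lemma linear_proj: "Vector_Spaces.linear hscale hscale (proj O')"
proof -
  have "proj O' (f + g) = proj O' f + proj O' g" for f g
    by (simp add: proj_def cinner_add_left hardy.scale_left_distrib sum.distrib)
  moreover have "proj O' (hscale c f) = hscale c (proj O' f)" for c f
    by (simp add: proj_def cinner_hscale_left hardy.scale_sum_right)
  ultimately show ?thesis
    by (simp add: Vector_Spaces.linear_iff vector_space_hscale)
qed

lemma proj_in_span: "proj O' f \<in> hardy.span O'"
  unfolding proj_def by (intro hardy.span_sum hardy.span_scale hardy.span_base)

lemma cinner_proj:
  assumes "orthonormal O'" "finite O'" "e \<in> O'"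
  shows "cinner (proj O' f) e = cinner f e"
proof -
  have "cinner (proj O' f) e = (\<Sum>x\<in>O'. cinner f x * cinner x e)"
    by (simp add: proj_def cinner_sum_left cinner_hscale_left)
  also have "\<dots> = (\<Sum>x\<in>O'. if x = e then cinner f x else 0)"
    by (rule sum.cong) (use orthonormal_cinner[OF assms(1)] assms(3) in auto)
  finally show ?thesis
    using assms by simp
qed

lemma orthonormal_independent:
  assumes "orthonormal O'" "finite O'"
  shows "hardy.independent O'"
proof (rule hardy.independent_if_scalars_zero[OF assms(2)])
  fix u e
  assume u: "(\<Sum>x\<in>O'. hscale (u x) x) = 0" and e: "e \<in> O'"
  have "0 = cinner (\<Sum>x\<in>O'. hscale (u x) x) e"
    by (simp add: u)
  also have "\<dots> = (\<Sum>x\<in>O'. u x * cinner x e)"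
    by (simp add: cinner_sum_left cinner_hscale_left)
  also have "\<dots> = (\<Sum>x\<in>O'. if x = e then u x else 0)"
    by (rule sum.cong) (use orthonormal_cinner[OF assms(1)] e in auto)
  finally show "u e = 0"
    using assms e by simp
qed

context bounded_hardy_operator
begin

definition eigenspace :: "real \<Rightarrow> hardy2 set" where
  "eigenspace \<sigma> = {f. A f = (\<sigma>\<^sup>2) *\<^sub>R f}"

lemma subspace_eigenspace: "hardy.subspace (eigenspace \<sigma>)"
  unfolding hardy.subspace_def eigenspace_def
  using A_hscale[of 0 0] by (auto simp: A_add A_hscale scaleR_add_right hscale_scaleR)

lemma inner_eigen: "f \<in> eigenspace \<sigma> \<Longrightarrow> T f \<bullet> T g = \<sigma>\<^sup>2 * (f \<bullet> g)"
  by (metis (mono_tags) eigenspace_def inner_A' inner_scaleR_left mem_Collect_eq)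

text \<open>Both eigenvalues compute the same number \<open>T f \<bullet> T g\<close>, so the real
  part vanishes; replacing \<open>g\<close> by \<open>hscale \<i> g\<close>, again an eigenvector,
  gives the imaginary part.\<close>

lemma eigen_orthogonal:
  assumes f: "f \<in> eigenspace \<sigma>" and g: "g \<in> eigenspace \<tau>" and ne: "\<sigma>\<^sup>2 \<noteq> \<tau>\<^sup>2"
  shows "cinner f g = 0"
proof -
  have *: "f \<bullet> k = 0" if k: "k \<in> eigenspace \<tau>" for k
    using inner_eigen[OF f, of k] inner_eigen[OF k, of f] ne by (simp add: inner_commute)
  have "hscale \<i> g \<in> eigenspace \<tau>"
    by (rule hardy.subspace_scale[OF subspace_eigenspace g])
  then show ?thesis
    using *[OF g] * by (simp add: cinner_eq_Complex complex_eq_iff)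
qed

text \<open>Orthonormal eigenvectors have orthogonal images of norms \<sigma> and \<tau>, whose
  squared distance is \<open>\<sigma>\<^sup>2 + \<tau>\<^sup>2\<close>, at least
  \<open>2 * \<epsilon>\<^sup>2\<close>.\<close>

lemma orthonormal_eigen_dist:
  assumes O': "orthonormal O'" "\<And>e. e \<in> O' \<Longrightarrow> \<exists>\<sigma>\<ge>\<epsilon>. e \<in> eigenspace \<sigma>" and \<epsilon>: "0 < \<epsilon>"
    and e: "e \<in> O'" "e' \<in> O'" "e \<noteq> e'"
  shows "\<epsilon> < dist (T e) (T e')"
proof -
  obtain \<sigma> \<tau> where s: "\<epsilon> \<le> \<sigma>" "e \<in> eigenspace \<sigma>" "\<epsilon> \<le> \<tau>" "e' \<in> eigenspace \<tau>"
    using O' e by meson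
  have 1: "e \<bullet> e' = 0" "e \<bullet> e = 1" "e' \<bullet> e' = 1"
    using O'(1) e by (auto simp: orthonormal_def Re_cinner[symmetric] cinner_self)
  have "(norm (T e - T e'))\<^sup>2 = T e \<bullet> T e - 2 * (T e \<bullet> T e') + T e' \<bullet> T e'"
    by (simp add: power2_norm_eq_inner inner_diff_left inner_diff_right inner_commute)
  also have "\<dots> = \<sigma>\<^sup>2 + \<tau>\<^sup>2"
    using 1 inner_eigen[OF s(2), of e] inner_eigen[OF s(2), of e'] inner_eigen[OF s(4), of e'] by simp
  also have "\<dots> > \<epsilon>\<^sup>2"
    using power_mono[OF s(1), of 2] power_mono[OF s(3), of 2] \<epsilon> zero_less_power[OF \<epsilon>, of 2] by linarith
  finally show ?thesis
    using \<epsilon> by (simp add: dist_norm power2_less_imp_less)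
qed

end

locale compact_hardy_operator = bounded_hardy_operator +
  assumes compact_T: "compact (closure (T ` cball 0 1))"
begin

text \<open>Pigeonhole: the images of the unit ball are covered by finitely many balls of radius
  \<open>\<epsilon> / 2\<close>, and no such ball contains two of the \<epsilon>-separated
  images.\<close>

lemma orthonormal_eigen_bounded:
  assumes \<epsilon>: "0 < \<epsilon>"
  obtains N where "\<And>O'. finite O' \<Longrightarrow> orthonormal O' \<Longrightarrow> (\<And>e. e \<in> O' \<Longrightarrow> \<exists>\<sigma>\<ge>\<epsilon>. e \<in> eigenspace \<sigma>) \<Longrightarrow> card O' \<le> N"
proof -
  obtain k where k: "finite k" "closure (T ` cball 0 1) \<subseteq> (\<Union>x\<in>k. ball x (\<epsilon> / 2))"
    using compact_T \<epsilon> unfolding compact_eq_totally_bounded by (meson half_gt_zero)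
  show thesis
  proof (rule that[of "card k"])
    fix O'
    assume O': "finite O'" "orthonormal O'" "\<And>e. e \<in> O' \<Longrightarrow> \<exists>\<sigma>\<ge>\<epsilon>. e \<in> eigenspace \<sigma>"
    have "\<exists>x\<in>k. dist x (T e) < \<epsilon> / 2" if "e \<in> O'" for e
    proof -
      have "T e \<in> closure (T ` cball 0 1)"
        using that O'(2) by (intro subsetD[OF closure_subset] imageI) (auto simp: orthonormal_def)
      then show ?thesis
        using k(2) by (auto dest!: subsetD simp del: less_divide_eq_numeral1)
    qed
    then obtain c where c: "\<And>e. e \<in> O' \<Longrightarrow> c e \<in> k \<and> dist (c e) (T e) < \<epsilon> / 2"
      by metis
    have "inj_on c O'"
    proof (rule inj_onI, rule ccontr)
      fix e e' assume e: "e \<in> O'" "e' \<in> O'" "c e = c e'" "e \<noteq> e'"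
      have "\<epsilon> < dist (T e) (T e')"
        by (rule orthonormal_eigen_dist[OF O'(2,3) \<epsilon> e(1,2,4)])
      moreover have "dist (T e) (T e') \<le> dist (c e) (T e) + dist (c e) (T e')"
        by (metis dist_commute dist_triangle)
      ultimately show False
        using c[OF e(1)] c[OF e(2)] e(3) by auto
    qed
    then show "card O' \<le> card k"
      by (rule card_inj_on_le) (use c k in auto)
  qed
qed

text \<open>If \<open>M\<close> is the norm of \<open>T\<close> restricted to \<open>E\<close>, a maximizing sequence of unit vectors \<open>g n\<close> satisfies
  \<open>A (g n) - M\<^sup>2 g n \<longlonglongrightarrow> 0\<close>; compactness makes \<open>A (g n)\<close>, hence \<open>g n\<close>, converge along a subsequence.
  Completeness of the Hardy space is not involved.\<close>

lemma exists_eigenvector_ge: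
  assumes E: "hardy.subspace E" "closed E" "\<And>f. f \<in> E \<Longrightarrow> A f \<in> E"
    and f: "f \<in> E" "f \<noteq> 0" and \<epsilon>: "0 < \<epsilon>" and ge: "\<epsilon> * norm f \<le> norm (T f)"
  obtains \<sigma> g where "\<epsilon> \<le> \<sigma>" "g \<in> eigenspace \<sigma>" "g \<in> E" "g \<noteq> 0"
proof -
  have scale: "r *\<^sub>R g \<in> E" if "g \<in> E" for r g
    using hardy.subspace_scale[OF E(1) that] by (simp add: scaleR_hardy2)
  define U where "U = {g \<in> E. norm g = 1}"
  define M where "M = (SUP g\<in>U. norm (T g))"
  have bdd: "bdd_above ((\<lambda>g. norm (T g)) ` U)"
    by (rule bdd_aboveI2[of _ _ K]) (metis (mono_tags, lifting) U_def bound mem_Collect_eq mult.right_neutral)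
  have le: "norm (T g) \<le> M * norm g" if g: "g \<in> E" for g
  proof (cases "g = 0")
    case False
    have "inverse (norm g) *\<^sub>R g \<in> U"
      using False g by (simp add: U_def scale)
    then have "norm (T (inverse (norm g) *\<^sub>R g)) \<le> M"
      unfolding M_def by (rule cSUP_upper[OF _ bdd])
    then show ?thesis
      using False by (simp add: T_scaleR field_simps)
  qed (simp add: T.zero)
  have "\<epsilon> * norm f \<le> M * norm f"
    using ge le[OF f(1)] by simp
  then have M: "\<epsilon> \<le> M"
    using f by simp
  then have M0: "0 < M" using \<epsilon> by simp
  have "inverse (norm f) *\<^sub>R f \<in> U"
    using f by (simp add: U_def scale)
  then have "U \<noteq> {}" by blast
  have "\<exists>g. g \<in> U \<and> M - inverse (real (Suc n)) < norm (T g)" for n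
  proof -
    have "M - inverse (real (Suc n)) < M" by simp
    then show ?thesis
      unfolding M_def less_cSUP_iff[OF \<open>U \<noteq> {}\<close> bdd] by blast
  qed
  then obtain g where g: "\<And>n. g n \<in> U" "\<And>n. M - inverse (real (Suc n)) < norm (T (g n))"
    by metis
  have gE: "g n \<in> E" "norm (g n) = 1" for n
    using g(1) by (auto simp: U_def)
  have lim: "(\<lambda>n. norm (T (g n))) \<longlonglongrightarrow> M"
  proof (rule tendsto_sandwich)
    show "(\<lambda>n. M - inverse (real (Suc n))) \<longlonglongrightarrow> M"
      using tendsto_diff[OF tendsto_const LIMSEQ_inverse_real_of_nat, of M] by simp
    show "\<forall>\<^sub>F n in sequentially. M - inverse (real (Suc n)) \<le> norm (T (g n))"
      using g(2) by (auto intro: always_eventually less_imp_le)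
    show "\<forall>\<^sub>F n in sequentially. norm (T (g n)) \<le> M"
      using le[OF gE(1)] gE(2) by (auto intro: always_eventually)
  qed simp
  have "T (g n) \<in> closure (T ` cball 0 1)" for n
    using gE by (intro subsetD[OF closure_subset] imageI) auto
  then obtain y r where r: "strict_mono r" "((\<lambda>n. T (g n)) \<circ> r) \<longlonglongrightarrow> y"
    using compact_T unfolding compact_def by meson
  \<comment> \<open>Invariance of \<open>E\<close> under \<open>A\<close> gives
    \<open>norm (A h) \<le> M * norm (T h)\<close>. Expanding the square with
    \<open>A h \<bullet> h = (norm (T h))\<^sup>2\<close> then bounds the residual by the distance
    of \<open>norm (T h)\<close> from its supremum.\<close>
  have res: "(norm (A h - (M\<^sup>2) *\<^sub>R h))\<^sup>2 \<le> M\<^sup>2 * (M\<^sup>2 - (norm (T h))\<^sup>2)" if h: "h \<in> E" "norm h = 1" for h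
  proof -
    have "norm (A h) * norm (A h) = T (A h) \<bullet> T h"
      using inner_A'[of "A h" h] inner_A'[of h "A h"] power2_norm_eq_inner[of "A h"]
      by (simp add: power2_eq_square inner_commute)
    also have "\<dots> \<le> norm (T (A h)) * norm (T h)"
      by (rule norm_cauchy_schwarz)
    also have "\<dots> \<le> M * norm (A h) * norm (T h)"
      by (intro mult_right_mono le E(3) h) auto
    finally have "norm (A h) * norm (A h) \<le> (M * norm (T h)) * norm (A h)"
      by (simp add: mult_ac)
    then have "norm (A h) \<le> M * norm (T h)"
      using M0 by (cases "norm (A h) = 0") (auto simp del: norm_eq_zero simp: mult_le_cancel_right)
    then have 1: "(norm (A h))\<^sup>2 \<le> (M * norm (T h))\<^sup>2"
      by (intro power_mono) auto
    have "(norm (A h - (M\<^sup>2) *\<^sub>R h))\<^sup>2 = (norm (A h))\<^sup>2 - 2 * M\<^sup>2 * (A h \<bullet> h) + M\<^sup>2 * M\<^sup>2 * (h \<bullet> h)"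
      by (simp add: power2_norm_eq_inner inner_diff_left inner_diff_right inner_commute algebra_simps)
    also have "A h \<bullet> h = (norm (T h))\<^sup>2"
      by (simp add: inner_A' power2_norm_eq_inner)
    also have "h \<bullet> h = 1"
      using h by (simp add: power2_norm_eq_inner[symmetric])
    finally show ?thesis
      using 1 by (simp add: power_mult_distrib algebra_simps)
  qed
  have "(\<lambda>n. M\<^sup>2 * (M\<^sup>2 - (norm (T (g n)))\<^sup>2)) \<longlonglongrightarrow> M\<^sup>2 * (M\<^sup>2 - M\<^sup>2)"
    by (intro tendsto_mult tendsto_diff tendsto_const tendsto_power lim)
  then have z: "(\<lambda>n. M\<^sup>2 * (M\<^sup>2 - (norm (T (g n)))\<^sup>2)) \<longlonglongrightarrow> 0"
    by simp
  have "(\<lambda>n. (norm (A (g n) - (M\<^sup>2) *\<^sub>R g n))\<^sup>2) \<longlonglongrightarrow> 0"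
    by (rule tendsto_sandwich[OF _ _ tendsto_const z])
       (use res[OF gE] in \<open>auto intro!: always_eventually\<close>)
  then have "(\<lambda>n. sqrt ((norm (A (g n) - (M\<^sup>2) *\<^sub>R g n))\<^sup>2)) \<longlonglongrightarrow> sqrt 0"
    by (rule tendsto_real_sqrt)
  then have "(\<lambda>n. A (g n) - (M\<^sup>2) *\<^sub>R g n) \<longlonglongrightarrow> 0"
    by (simp add: tendsto_norm_zero_iff)
  then have d: "(\<lambda>n. A (g (r n)) - (M\<^sup>2) *\<^sub>R g (r n)) \<longlonglongrightarrow> 0"
    using LIMSEQ_subseq_LIMSEQ[OF _ r(1)] by (force simp: o_def)
  have a: "(\<lambda>n. A (g (r n))) \<longlonglongrightarrow> adjoint T y"
    using tendsto_adjoint[OF r(2)] by (simp add: A_def o_def)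
  define l where "l = (1 / M\<^sup>2) *\<^sub>R adjoint T y"
  \<comment> \<open>Division by \<open>M\<^sup>2 > 0\<close> recovers the maximizing vectors from
    \<open>A (g n)\<close> and the residual, and both of these converge along the
    subsequence.\<close>
  have "(\<lambda>n. (1 / M\<^sup>2) *\<^sub>R (A (g (r n)) - (A (g (r n)) - (M\<^sup>2) *\<^sub>R g (r n)))) \<longlonglongrightarrow> (1 / M\<^sup>2) *\<^sub>R (adjoint T y - 0)"
    by (intro tendsto_scaleR tendsto_const tendsto_diff a d)
  then have l: "(\<lambda>n. g (r n)) \<longlonglongrightarrow> l"
    using M0 by (simp add: l_def)
  have "l \<in> E"
    using closed_sequentially[OF E(2) _ l] gE by auto
  moreover have "norm l = 1"
    using tendsto_norm[OF l] gE by (simp add: LIMSEQ_const_iff)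
  moreover have "(\<lambda>n. A (g (r n))) \<longlonglongrightarrow> A l"
    unfolding A_def by (intro tendsto_adjoint tendsto_T l)
  then have "A l = adjoint T y"
    using a by (rule LIMSEQ_unique)
  then have "A l = M\<^sup>2 *\<^sub>R l"
    using M0 by (simp add: l_def)
  then have "l \<in> eigenspace M"
    by (simp add: eigenspace_def)
  ultimately show thesis
    using that[of M l] M by force
qed

text \<open>A largest orthonormal set \<open>O'\<close> of eigenvectors with eigenvalue at least \<open>\<epsilon>\<^sup>2\<close> spans the
  eigenspaces in question, so its size is counted by the singular numbers. If \<open>F\<close> were larger, its
  span would contain a nonzero vector orthogonal to \<open>O'\<close>, and the previous lemma would give a
  further eigenvector orthogonal to \<open>O'\<close>.\<close>

lemma card_le_singular_numbers:
  assumes s: "is_singular_numbers T s" and \<epsilon>: "0 < \<epsilon>"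
    and F: "finite F" "hardy.independent F" and ge: "\<And>f. f \<in> hardy.span F \<Longrightarrow> \<epsilon> * norm f \<le> norm (T f)"
  shows "card F \<le> card {n. \<epsilon> \<le> s n}" and "finite {n. \<epsilon> \<le> s n}"
proof -
  have s0: "s \<longlonglongrightarrow> 0"
    and dim: "\<And>\<sigma>. 0 < \<sigma> \<Longrightarrow> card {n. s n = \<sigma>} = hardy.dim (eigenspace \<sigma>)"
    using s by (auto simp: is_singular_numbers_def eigenspace_def A_def)
  have "eventually (\<lambda>n. s n < \<epsilon>) sequentially"
    using order_tendstoD(2)[OF s0 \<epsilon>] .
  then obtain n0 where "\<And>n. n \<ge> n0 \<Longrightarrow> s n < \<epsilon>"
    by (auto simp: eventually_sequentially)
  then have "{n. \<epsilon> \<le> s n} \<subseteq> {..<n0}"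
    by (force simp: not_less[symmetric])
  then show fin: "finite {n. \<epsilon> \<le> s n}"
    by (rule finite_subset) simp
  define good where "good O' \<longleftrightarrow> finite O' \<and> orthonormal O' \<and> (\<forall>e\<in>O'. \<exists>\<sigma>\<ge>\<epsilon>. e \<in> eigenspace \<sigma>)" for O'
  obtain N where "\<And>O'. good O' \<Longrightarrow> card O' \<le> N"
    using orthonormal_eigen_bounded[OF \<epsilon>] unfolding good_def by metis
  then have "\<exists>O'. good O' \<and> (\<forall>P. good P \<longrightarrow> card P \<le> card O')"
    by (intro ex_has_greatest_nat[of good "{}" card "Suc N"]) (auto simp: good_def orthonormal_def less_Suc_eq_le)
  then obtain O' where O': "good O'" and max: "\<And>P. good P \<Longrightarrow> card P \<le> card O'"
    by blast
  have O'fin: "finite O'" and O'on: "orthonormal O'" and O'eig: "\<And>e. e \<in> O' \<Longrightarrow> \<exists>\<sigma>\<ge>\<epsilon>. e \<in> eigenspace \<sigma>"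
    using O' by (auto simp: good_def)
  have on_sub: "orthonormal (O' \<inter> V)" for V
    using O'on by (auto simp: orthonormal_def)
  have span: "eigenspace \<sigma> \<subseteq> hardy.span (O' \<inter> eigenspace \<sigma>)" if \<sigma>: "\<epsilon> \<le> \<sigma>" for \<sigma>
  proof (rule ccontr)
    assume "\<not> eigenspace \<sigma> \<subseteq> hardy.span (O' \<inter> eigenspace \<sigma>)"
    then obtain v where v: "v \<in> eigenspace \<sigma>" "v \<notin> hardy.span (O' \<inter> eigenspace \<sigma>)"
      by blast
    \<comment> \<open>One Gram-Schmidt step inside the eigenspace. The remaining members of
      \<open>O'\<close> belong to other eigenvalues and are orthogonal to \<open>w\<close> anyway,
      so its normalization would enlarge the maximal set.\<close>
    define w where "w = v - proj (O' \<inter> eigenspace \<sigma>) v"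
    have "proj (O' \<inter> eigenspace \<sigma>) v \<in> eigenspace \<sigma>"
      unfolding proj_def
      by (intro hardy.subspace_sum hardy.subspace_scale subspace_eigenspace) auto
    then have weig: "w \<in> eigenspace \<sigma>"
      unfolding w_def by (intro hardy.subspace_diff subspace_eigenspace v)
    have "w \<noteq> 0"
      using v(2) proj_in_span[of "O' \<inter> eigenspace \<sigma>" v] by (auto simp: w_def)
    have w0: "cinner w e = 0" if e: "e \<in> O'" for e
    proof (cases "e \<in> eigenspace \<sigma>")
      case True
      then show ?thesis
        using cinner_proj[OF on_sub, of "eigenspace \<sigma>" e v] O'fin e by (simp add: w_def cinner_diff_left)
    next
      case False
      obtain \<tau> where \<tau>: "\<epsilon> \<le> \<tau>" "e \<in> eigenspace \<tau>"
        using O'eig[OF e] by blast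
      have "\<sigma> \<noteq> \<tau>"
        using False \<tau> by auto
      then have "\<sigma>\<^sup>2 \<noteq> \<tau>\<^sup>2"
        using \<sigma> \<tau> \<epsilon> by (simp add: power2_eq_iff)
      then show ?thesis
        by (rule eigen_orthogonal[OF weig \<tau>(2)])
    qed
    define u where "u = hscale (of_real (inverse (norm w))) w"
    have u1: "norm u = 1"
      using \<open>w \<noteq> 0\<close> by (simp add: u_def norm_hscale norm_inverse)
    have u0: "cinner u e = 0" "cinner e u = 0" if "e \<in> O'" for e
    proof -
      show "cinner u e = 0"
        using w0[OF that] by (simp add: u_def cinner_hscale_left)
      then show "cinner e u = 0"
        by (metis cnj_cinner complex_cnj_zero)
    qed
    have "u \<notin> O'"
    proof
      assume "u \<in> O'"
      then have "cinner u u = 0" by (rule u0)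
      then show False using u1 by (simp add: cinner_self)
    qed
    have "u \<in> eigenspace \<sigma>"
      unfolding u_def by (rule hardy.subspace_scale[OF subspace_eigenspace weig])
    then have "good (insert u O')"
      using O'fin O'eig O'on u0 u1 \<sigma> by (auto simp: good_def orthonormal_def)
    then show False
      using max[of "insert u O'"] O'fin \<open>u \<notin> O'\<close> by simp
  qed
  have dimO: "card {n. s n = \<sigma>} = card (O' \<inter> eigenspace \<sigma>)" if "\<epsilon> \<le> \<sigma>" for \<sigma>
  proof -
    have "hardy.dim (eigenspace \<sigma>) = card (O' \<inter> eigenspace \<sigma>)"
      by (rule hardy.dim_unique[OF _ span[OF that] orthonormal_independent[OF on_sub]])
         (use O'fin in auto)
    then show ?thesis
      using dim[of \<sigma>] that \<epsilon> by simp
  qed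
  obtain ev where ev: "\<And>e. e \<in> O' \<Longrightarrow> \<epsilon> \<le> ev e \<and> e \<in> eigenspace (ev e)"
    using O'eig by metis
  have "card O' \<le> card {n. \<epsilon> \<le> s n}"
  proof -
    have "O' = (\<Union>\<sigma>\<in>ev ` O'. O' \<inter> eigenspace \<sigma>)"
      using ev by auto
    then have "card O' \<le> (\<Sum>\<sigma>\<in>ev ` O'. card (O' \<inter> eigenspace \<sigma>))"
      using card_UN_le[of "ev ` O'" "\<lambda>\<sigma>. O' \<inter> eigenspace \<sigma>"] O'fin by simp
    also have "\<dots> = (\<Sum>\<sigma>\<in>ev ` O'. card {n. s n = \<sigma>})"
      by (rule sum.cong) (use dimO ev in auto)
    also have "\<dots> = card (\<Union>\<sigma>\<in>ev ` O'. {n. s n = \<sigma>})"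
      by (rule card_UN_disjoint[symmetric])
         (use O'fin ev in \<open>auto intro: finite_subset[OF _ fin]\<close>)
    also have "\<dots> \<le> card {n. \<epsilon> \<le> s n}"
      by (rule card_mono[OF fin]) (use ev in auto)
    finally show ?thesis .
  qed
  moreover have "card F \<le> card O'"
  proof (rule ccontr)
    assume less: "\<not> card F \<le> card O'"
    interpret P: Vector_Spaces.linear hscale hscale "proj O'"
      by (rule linear_proj)
    \<comment> \<open>An injective projection would turn \<open>F\<close> into more independent
      vectors than \<open>O'\<close> has elements, all within the span of \<open>O'\<close>.\<close>
    have "\<not> inj_on (proj O') (hardy.span F)"
    proof
      assume inj: "inj_on (proj O') (hardy.span F)"
      then have "hardy.independent (proj O' ` F)"
        by (rule P.independent_injective_image[OF F(2)])
      moreover have "card (proj O' ` F) = card F"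
        by (rule card_image) (rule inj_on_subset[OF inj hardy.span_superset])
      moreover have "proj O' ` F \<subseteq> hardy.span O'"
        using proj_in_span by auto
      ultimately show False
        using hardy.independent_span_bound[OF O'fin, of "proj O' ` F"] less by simp
    qed
    then obtain f where f: "f \<in> hardy.span F" "proj O' f = 0" "f \<noteq> 0"
      unfolding P.inj_on_iff_eq_0[OF hardy.subspace_span] by blast
    define E where "E = {g. \<forall>e\<in>O'. cinner g e = 0}"
    have E_inner: "g \<in> E \<longleftrightarrow> (\<forall>e\<in>O'. g \<bullet> e = 0 \<and> g \<bullet> hscale \<i> e = 0)" for g
      by (auto simp: E_def cinner_eq_Complex complex_eq_iff)
    have E_span: "cinner g e = 0" if "g \<in> E" "e \<in> hardy.span O'" for g e
    proof -
      have "hardy.subspace {e. cinner e g = 0}"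
        by (auto simp: hardy.subspace_def cinner_add_left cinner_hscale_left)
      moreover have "O' \<subseteq> {e. cinner e g = 0}"
        using that(1) unfolding E_def by (auto simp: cnj_cinner[symmetric, of _ g])
      ultimately have "e \<in> {e. cinner e g = 0}"
        using hardy.span_minimal that(2) by blast
      then show ?thesis
        using cnj_cinner[of e g] by simp
    qed
    have "E = (\<Inter>e\<in>O'. {g. g \<bullet> e = 0} \<inter> {g. g \<bullet> hscale \<i> e = 0})"
      using E_inner by auto
    moreover have "closed (\<Inter>e\<in>O'. {g. g \<bullet> e = 0} \<inter> {g. g \<bullet> hscale \<i> e = 0})"
      by (intro closed_INT ballI closed_Int closed_Collect_eq continuous_intros)
    ultimately have "closed E" by simp
    moreover have "hardy.subspace E"
      by (auto simp: hardy.subspace_def E_def cinner_add_left cinner_hscale_left)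
    \<comment> \<open>By symmetry of \<open>A\<close>, pairing \<open>A g\<close> with an
      eigenvector from the span of \<open>O'\<close> multiplies the pairing with \<open>g\<close> by
      the eigenvalue. This is applied to \<open>e\<close> and to
      \<open>hscale \<i> e\<close>.\<close>
    moreover have "A g \<in> E" if g: "g \<in> E" for g
    proof -
      have "A g \<bullet> e = 0" if e: "e \<in> eigenspace \<sigma>" "e \<in> hardy.span O'" for e \<sigma>
      proof -
        have "g \<bullet> e = 0"
          using E_span[OF g e(2)] by (simp add: Re_cinner[symmetric])
        then show ?thesis
          using inner_eigen[OF e(1), of g] inner_A'[of g e] by (simp add: inner_commute)
      qed
      then show ?thesis
        unfolding E_inner using ev subspace_eigenspace
        by (metis hardy.span_base hardy.span_scale hardy.subspace_scale)
    qed
    moreover have "f \<in> E"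
      using cinner_proj[OF O'on O'fin, of _ f] f(2) by (simp add: E_def)
    ultimately obtain \<sigma> g where g: "\<epsilon> \<le> \<sigma>" "g \<in> eigenspace \<sigma>" "g \<in> E" "g \<noteq> 0"
      using exists_eigenvector_ge[of E f \<epsilon>] f \<epsilon> ge[OF f(1)] by metis
    \<comment> \<open>The new eigenvector has eigenvalue at least \<open>\<epsilon>\<^sup>2\<close>,
      so maximality already places it in the span of \<open>O'\<close>, to which it is
      orthogonal.\<close>
    have "g \<in> hardy.span O'"
      using span[OF g(1)] g(2) hardy.span_mono[of "O' \<inter> eigenspace \<sigma>" O'] by blast
    then have "cinner g g = 0"
      by (rule E_span[OF g(3)])
    then show False
      using g(4) by (simp add: cinner_self)
  qed
  ultimately show "card F \<le> card {n. \<epsilon> \<le> s n}"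
    by simp
qed

end

section \<open>Reproducing kernels at lacunary distances\<close>

lemma hardy_fun_of_coeffs:
  assumes "summable (\<lambda>n. (norm (b n))\<^sup>2)" "norm z < 1"
  shows "(\<lambda>n. b n * z ^ n) sums hardy_fun (of_coeffs b) z"
  using taylor_sums[OF hardy_fun_holomorphic[of "of_coeffs b"] assms(2)]
  by (simp add: hcoeff_of_coeffs[OF assms(1)])

text \<open>A multiple of the reproducing kernel of the point \<open>\<xi> / (1 + t)\<close>.\<close>

definition kernel :: "complex \<Rightarrow> real \<Rightarrow> hardy2" where
  "kernel \<xi> t = hscale (of_real (sqrt t / (1 + t))) (of_coeffs (\<lambda>n. (cnj \<xi> / of_real (1 + t)) ^ n))"

lemma norm_of_real_1_plus: "0 < t \<Longrightarrow> norm (of_real (1 + t) :: complex) = 1 + t"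
  by (simp only: norm_of_real)

context
  fixes \<xi> :: complex
  assumes \<xi>: "norm \<xi> = 1"
begin

lemma summable_kernel_coeffs:
  assumes "0 < t"
  shows "summable (\<lambda>n. (norm ((cnj \<xi> / of_real (1 + t)) ^ n))\<^sup>2)"
proof -
  have "(norm ((cnj \<xi> / of_real (1 + t)) ^ n))\<^sup>2 = ((1 / (1 + t))\<^sup>2) ^ n" for n
    using assms \<xi> by (simp only: norm_power norm_divide norm_of_real_1_plus complex_mod_cnj) (metis mult.commute power_mult)
  moreover have "norm ((1 / (1 + t))\<^sup>2) < 1"
    using assms by (simp add: power_less_one_iff abs_square_less_1)
  ultimately show ?thesis
    by (simp add: summable_geometric)
qed

lemma hardy_fun_kernel:
  assumes t: "0 < t" and z: "norm z < 1"
  shows "hardy_fun (kernel \<xi> t) z = of_real (sqrt t) / (of_real t + (1 - cnj \<xi> * z))"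
proof -
  define a where "a = cnj \<xi> / of_real (1 + t)"
  have "norm (a * z) < 1"
  proof -
    have "norm (a * z) = norm z / (1 + t)"
      using \<xi> t by (simp add: a_def norm_mult norm_divide norm_of_real_1_plus del: of_real_add)
    then show ?thesis using t z by simp
  qed
  then have "(\<lambda>n. (a * z) ^ n) sums (1 / (1 - a * z))"
    by (rule geometric_sums)
  then have "hardy_fun (of_coeffs (\<lambda>n. a ^ n)) z = 1 / (1 - a * z)"
    using hardy_fun_of_coeffs[OF summable_kernel_coeffs[OF t] z, folded a_def]
    unfolding power_mult_distrib by (metis sums_unique2)
  moreover have "1 - a * z = (of_real t + (1 - cnj \<xi> * z)) / of_real (1 + t)"
  proof -
    have "of_real (1 + t) \<noteq> (0 :: complex)"
      using t by (simp only: of_real_eq_0_iff)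
    moreover have "of_real t + (1 - cnj \<xi> * z) = of_real (1 + t) - cnj \<xi> * z"
      by simp
    ultimately show ?thesis
      by (simp only: a_def diff_divide_distrib divide_self times_divide_eq_left simp_thms)
  qed
  moreover have "of_real (sqrt t / (1 + t)) * (1 / (w / of_real (1 + t))) = of_real (sqrt t) / w" for w :: complex
  proof -
    have "of_real (1 + t) \<noteq> (0 :: complex)"
      using t by (simp only: of_real_eq_0_iff)
    then show ?thesis
      by (simp only: of_real_divide) simp
  qed
  ultimately show ?thesis
    by (simp only: kernel_def hardy_fun_hscale a_def[symmetric])
qed

text \<open>A geometric series of ratio \<open>x = 1 / ((1 + t) * (1 + u))\<close>. For
  \<open>t \<le> u\<close> the value is at most \<open>sqrt (t / u)\<close>, which is small for
  widely separated parameters; on the diagonal it is \<open>1 / (2 + t)\<close>.\<close>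

lemma cinner_kernel:
  assumes t: "0 < t" and u: "0 < u"
  shows "cinner (kernel \<xi> t) (kernel \<xi> u) = of_real (sqrt t * sqrt u / (t + u + t * u))"
proof -
  define x where "x = 1 / ((1 + t) * (1 + u))"
  have x: "norm x < 1"
    using t u by (simp add: x_def) (simp add: algebra_simps add_pos_pos)
  have xi: "cnj \<xi> * \<xi> = 1"
    using complex_norm_square[of \<xi>] \<xi> by (simp add: mult.commute)
  have "(cnj \<xi> / of_real (1 + t)) ^ n * cnj ((cnj \<xi> / of_real (1 + u)) ^ n) = of_real (x ^ n)" for n
  proof -
    have "(cnj \<xi> / of_real (1 + t)) ^ n * cnj ((cnj \<xi> / of_real (1 + u)) ^ n) = ((cnj \<xi> * \<xi>) / (of_real (1 + t) * of_real (1 + u))) ^ n"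
      by (simp add: power_mult_distrib[symmetric])
    then show ?thesis
      by (simp add: xi x_def)
  qed
  moreover have "(\<lambda>n. of_real (x ^ n) :: complex) sums of_real (1 / (1 - x))"
    by (intro sums_of_real geometric_sums x)
  ultimately have "cinner (of_coeffs (\<lambda>n. (cnj \<xi> / of_real (1 + t)) ^ n)) (of_coeffs (\<lambda>n. (cnj \<xi> / of_real (1 + u)) ^ n)) = of_real (1 / (1 - x))"
    using cinner_sums[of "of_coeffs (\<lambda>n. (cnj \<xi> / of_real (1 + t)) ^ n)" "of_coeffs (\<lambda>n. (cnj \<xi> / of_real (1 + u)) ^ n)"]
    by (simp only: hcoeff_of_coeffs[OF summable_kernel_coeffs[OF t]] hcoeff_of_coeffs[OF summable_kernel_coeffs[OF u]] sums_unique2)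
  then have "cinner (kernel \<xi> t) (kernel \<xi> u) = of_real (sqrt t / (1 + t) * (sqrt u / (1 + u)) * (1 / (1 - x)))"
    unfolding kernel_def cinner_hscale_left cinner_hscale_right by (simp add: mult_ac)
  also have "sqrt t / (1 + t) * (sqrt u / (1 + u)) * (1 / (1 - x)) = sqrt t * sqrt u / (t + u + t * u)"
  proof -
    have "1 - x = (t + u + t * u) / ((1 + t) * (1 + u))"
    proof -
      have "t + u + t * u = (1 + t) * (1 + u) - 1"
        by (simp add: algebra_simps)
      moreover have "(1 + t) * (1 + u) \<noteq> 0"
        using t u by simp
      ultimately show ?thesis
        by (simp add: x_def diff_divide_distrib)
    qed
    moreover have "t + u + t * u \<noteq> 0"
      using t u by (simp add: add_pos_pos less_imp_neq[symmetric])
    ultimately show ?thesis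
      using t u by simp
  qed
  finally show ?thesis .
qed

end

text \<open>With truncated subtraction \<open>i - j + (j - i)\<close> is the distance of the two
  indices. The diagonal is set to 0 because only off-diagonal interaction is to be
  estimated.\<close>

definition gap_weight :: "nat \<Rightarrow> nat \<Rightarrow> real" where
  "gap_weight i j = (if i = j then 0 else (1 / 5000) ^ (i - j + (j - i)))"

lemma gap_weight_nonneg: "0 \<le> gap_weight i j"
  by (simp add: gap_weight_def)

lemma gap_weight_commute: "gap_weight i j = gap_weight j i"
  by (simp add: gap_weight_def add.commute)

text \<open>On either side of \<open>j\<close> the distances are distinct and positive, so each half
  is dominated by a geometric series without its constant term, of sum 1/4999.\<close>

lemma sum_gap_weight: "(\<Sum>i<N. gap_weight i j) \<le> 2 / 4999"
proof -
  have part: "(\<Sum>i\<in>B. gap_weight i j) \<le> 1 / 4999"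
    if B: "finite B" "\<And>i. i \<in> B \<Longrightarrow> i \<noteq> j" "inj_on (\<lambda>i. i - j + (j - i) - 1) B" for B
  proof -
    have "(\<Sum>i\<in>B. gap_weight i j) = (\<Sum>i\<in>B. (1 / 5000) * (1 / 5000) ^ (i - j + (j - i) - 1))"
    proof (rule sum.cong)
      fix i assume "i \<in> B"
      then have "i - j + (j - i) = Suc (i - j + (j - i) - 1)"
        using B(2)[of i] by (cases "i < j") auto
      then show "gap_weight i j = (1 / 5000) * (1 / 5000) ^ (i - j + (j - i) - 1)"
        using B(2) \<open>i \<in> B\<close> unfolding gap_weight_def by (metis power_Suc)
    qed simp
    also have "\<dots> = (\<Sum>n\<in>(\<lambda>i. i - j + (j - i) - 1) ` B. (1 / 5000) * (1 / 5000) ^ n)"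
      by (subst sum.reindex[OF B(3)]) (simp add: o_def)
    also have "\<dots> \<le> (\<Sum>n. (1 / 5000) * (1 / 5000 :: real) ^ n)"
      by (rule sum_le_suminf) (use B in \<open>auto intro!: summable_mult summable_geometric\<close>)
    also have "\<dots> = 1 / 4999"
      by (subst suminf_mult) (auto simp: suminf_geometric summable_geometric)
    finally show ?thesis .
  qed
  have "(\<Sum>i<N. gap_weight i j) = (\<Sum>i\<in>{i. i < N \<and> i < j}. gap_weight i j) + (\<Sum>i\<in>{i. i < N \<and> j \<le> i}. gap_weight i j)"
    by (subst sum.union_disjoint[symmetric]) (auto intro!: sum.cong)
  also have "(\<Sum>i\<in>{i. i < N \<and> j \<le> i}. gap_weight i j) = (\<Sum>i\<in>{i. i < N \<and> j < i}. gap_weight i j)"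
    by (rule sum.mono_neutral_right) (auto simp: gap_weight_def)
  also have "(\<Sum>i\<in>{i. i < N \<and> i < j}. gap_weight i j) \<le> 1 / 4999"
    by (rule part) (auto simp: inj_on_def)
  also have "(\<Sum>i\<in>{i. i < N \<and> j < i}. gap_weight i j) \<le> 1 / 4999"
    by (rule part) (auto simp: inj_on_def)
  finally show ?thesis by simp
qed

text \<open>Schur test: each weight is split into two square roots for Cauchy-Schwarz, and the row
  and column sums each contribute one factor \<open>2 / 4999\<close>.\<close>

lemma schur_gap_weight:
  "(\<Sum>j<N. (\<Sum>i<N. gap_weight i j * x i)\<^sup>2) \<le> (2 / 4999)\<^sup>2 * (\<Sum>i<N. (x i)\<^sup>2)"
proof -
  have "(\<Sum>i<N. gap_weight i j * x i)\<^sup>2 \<le> 2 / 4999 * (\<Sum>i<N. gap_weight i j * (x i)\<^sup>2)" for j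
  proof -
    have "(\<Sum>i<N. gap_weight i j * x i)\<^sup>2 = (\<Sum>i<N. sqrt (gap_weight i j) * (sqrt (gap_weight i j) * x i))\<^sup>2"
      using gap_weight_nonneg by (simp add: mult.assoc[symmetric])
    also have "\<dots> \<le> (\<Sum>i<N. (sqrt (gap_weight i j))\<^sup>2) * (\<Sum>i<N. (sqrt (gap_weight i j) * x i)\<^sup>2)"
      by (rule Cauchy_Schwarz_ineq_sum)
    also have "\<dots> = (\<Sum>i<N. gap_weight i j) * (\<Sum>i<N. gap_weight i j * (x i)\<^sup>2)"
      using gap_weight_nonneg by (simp add: power_mult_distrib)
    also have "\<dots> \<le> 2 / 4999 * (\<Sum>i<N. gap_weight i j * (x i)\<^sup>2)"
      by (intro mult_right_mono sum_gap_weight sum_nonneg mult_nonneg_nonneg gap_weight_nonneg) auto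
    finally show ?thesis .
  qed
  then have "(\<Sum>j<N. (\<Sum>i<N. gap_weight i j * x i)\<^sup>2) \<le> (\<Sum>j<N. 2 / 4999 * (\<Sum>i<N. gap_weight i j * (x i)\<^sup>2))"
    by (rule sum_mono)
  also have "\<dots> = 2 / 4999 * (\<Sum>i<N. \<Sum>j<N. gap_weight i j * (x i)\<^sup>2)"
    unfolding sum_distrib_left[symmetric] by (subst sum.swap) simp
  also have "\<dots> = 2 / 4999 * (\<Sum>i<N. (x i)\<^sup>2 * (\<Sum>j<N. gap_weight j i))"
    by (simp only: sum_distrib_left) (simp only: gap_weight_commute mult.commute)
  also have "\<dots> \<le> 2 / 4999 * (\<Sum>i<N. (x i)\<^sup>2 * (2 / 4999))"
    by (intro mult_left_mono sum_mono sum_gap_weight) auto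
  finally show ?thesis
    by (simp add: sum_distrib_right[symmetric] power2_eq_square sum_divide_distrib[symmetric])
qed

section \<open>Composition operators on spans of kernels\<close>

text \<open>The exponent is even because kernels interact through square roots of ratios, which thus
  become powers of 5000. Starting at \<open>i + 1\<close> puts even the smallest scale above
  \<open>16 * h\<close>, where homogeneity applies.\<close>

definition scale :: "real \<Rightarrow> nat \<Rightarrow> real" where
  "scale h i = h * 5000 ^ (2 * (i + 1))"

lemma scale_pos: "0 < h \<Longrightarrow> 0 < scale h i"
  by (simp add: scale_def)

lemma sqrt_scale: "0 < h \<Longrightarrow> sqrt (scale h i) = sqrt h * 5000 ^ (i + 1)"
  unfolding scale_def power_even_eq by (simp add: real_sqrt_mult)

lemma sqrt_scale_ratio:
  assumes "0 < h" "i \<le> j"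
  shows "sqrt (scale h i) / sqrt (scale h j) = (1 / 5000) ^ (j - i)"
proof -
  have "(5000 :: real) ^ (j + 1) = 5000 ^ (j - i) * 5000 ^ (i + 1)"
    using assms by (simp flip: power_add)
  then show ?thesis
    using assms by (simp add: sqrt_scale power_one_over)
qed

text \<open>This makes the shells of different indices disjoint.\<close>

lemma scale_less: "0 < h \<Longrightarrow> i < j \<Longrightarrow> scale h i \<le> scale h j / 272"
proof -
  assume h: "0 < h" "i < j"
  obtain k where "j = Suc (i + k)"
    using less_imp_Suc_add[OF h(2)] by blast
  then have "scale h j = scale h (Suc i) * 5000 ^ (2 * k)"
    by (simp add: scale_def power_add)
  also have "\<dots> \<ge> scale h (Suc i) * 1"
    using scale_pos[OF h(1), of "Suc i"] by (intro mult_left_mono one_le_power) auto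
  finally have "scale h (Suc i) \<le> scale h j" by simp
  moreover have "272 * scale h i \<le> scale h (Suc i)"
    using h by (simp add: scale_def)
  ultimately show ?thesis by simp
qed

lemma norm_cinner_kernel_le:
  assumes \<xi>: "norm \<xi> = 1" and h: "0 < h"
  shows "norm (cinner (kernel \<xi> (scale h i)) (kernel \<xi> (scale h j))) \<le> (if i = j then 1 else 0) + gap_weight i j"
proof -
  have le: "norm (cinner (kernel \<xi> (scale h i)) (kernel \<xi> (scale h j))) \<le> (1 / 5000) ^ (j - i)" if "i \<le> j" for i j
  proof -
    define t u where "t = scale h i" and "u = scale h j"
    have tu: "0 < t" "0 < u"
      using scale_pos[OF h] by (auto simp: t_def u_def)
    have "norm (cinner (kernel \<xi> t) (kernel \<xi> u)) = sqrt t * sqrt u / (t + u + t * u)"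
      unfolding cinner_kernel[OF \<xi> tu] norm_of_real using tu by (simp add: abs_of_nonneg)
    also have "\<dots> \<le> sqrt t * sqrt u / u"
      using tu by (intro divide_left_mono) (auto intro!: mult_pos_pos add_pos_pos)
    also have "\<dots> = sqrt t / sqrt u"
      using tu by (simp add: real_div_sqrt field_simps)
    also have "\<dots> = (1 / 5000) ^ (j - i)"
      unfolding t_def u_def by (rule sqrt_scale_ratio[OF h that])
    finally show ?thesis
      by (simp add: t_def u_def)
  qed
  have sym: "norm (cinner (kernel \<xi> (scale h i)) (kernel \<xi> (scale h j))) = norm (cinner (kernel \<xi> (scale h j)) (kernel \<xi> (scale h i)))"
    by (metis cnj_cinner complex_mod_cnj)
  show ?thesis
    using le[of i j] le[of j i] sym by (cases i j rule: linorder_cases) (auto simp: gap_weight_def)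
qed

text \<open>The Gram entries are bounded by those of the identity plus the gap weights. With
  \<open>2 * a * b \<le> a\<^sup>2 + b\<^sup>2\<close> on the cross terms the constant is
  \<open>1 + 2 / 4999\<close>, rounded up to 2.\<close>

lemma norm_kernel_sum_le:
  assumes \<xi>: "norm \<xi> = 1" and h: "0 < h"
  shows "(norm (\<Sum>i<N. hscale (c i) (kernel \<xi> (scale h i))))\<^sup>2 \<le> 2 * (\<Sum>i<N. (norm (c i))\<^sup>2)"
proof -
  define k where "k i = kernel \<xi> (scale h i)" for i
  define f where "f = (\<Sum>i<N. hscale (c i) (k i))"
  define S where "S = (\<Sum>i<N. (norm (c i))\<^sup>2)"
  have "(norm f)\<^sup>2 = norm (cinner f f)"
    by (simp add: cinner_self norm_power)
  also have "cinner f f = (\<Sum>i<N. \<Sum>j<N. c i * cnj (c j) * cinner (k i) (k j))"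
    unfolding f_def cinner_sum_left cinner_hscale_left cinner_sum_right cinner_hscale_right sum_distrib_left
    by (subst sum.swap) (simp add: mult_ac)
  also have "norm \<dots> \<le> (\<Sum>i<N. \<Sum>j<N. norm (c i * cnj (c j) * cinner (k i) (k j)))"
    by (intro order_trans[OF norm_sum] sum_mono norm_sum)
  also have "\<dots> \<le> (\<Sum>i<N. \<Sum>j<N. (if i = j then (norm (c i))\<^sup>2 else 0)
      + gap_weight i j * ((norm (c i))\<^sup>2 + (norm (c j))\<^sup>2) / 2)"
  proof (intro sum_mono)
    fix i j
    have "norm (c i * cnj (c j) * cinner (k i) (k j)) \<le> norm (c i) * norm (c j) * ((if i = j then 1 else 0) + gap_weight i j)"
      using norm_cinner_kernel_le[OF \<xi> h, of i j]
      by (auto simp: norm_mult k_def intro!: mult_left_mono)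
    also have "\<dots> = (if i = j then (norm (c i))\<^sup>2 else 0) + gap_weight i j * (norm (c i) * norm (c j))"
      by (simp add: algebra_simps power2_eq_square)
    also have "gap_weight i j * (norm (c i) * norm (c j)) \<le> gap_weight i j * (((norm (c i))\<^sup>2 + (norm (c j))\<^sup>2) / 2)"
      using sum_squares_bound[of "norm (c i)" "norm (c j)"]
      by (intro mult_left_mono gap_weight_nonneg) simp
    finally show "norm (c i * cnj (c j) * cinner (k i) (k j)) \<le> (if i = j then (norm (c i))\<^sup>2 else 0)
      + gap_weight i j * ((norm (c i))\<^sup>2 + (norm (c j))\<^sup>2) / 2" by simp
  qed
  also have "\<dots> = S + (\<Sum>i<N. \<Sum>j<N. gap_weight i j * (norm (c i))\<^sup>2) / 2 + (\<Sum>i<N. \<Sum>j<N. gap_weight i j * (norm (c j))\<^sup>2) / 2"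
    by (simp add: S_def sum.distrib distrib_left add_divide_distrib sum_divide_distrib)
  also have "(\<Sum>i<N. \<Sum>j<N. gap_weight i j * (norm (c j))\<^sup>2) = (\<Sum>i<N. \<Sum>j<N. gap_weight i j * (norm (c i))\<^sup>2)"
    by (subst sum.swap) (simp only: gap_weight_commute)
  also have "(\<Sum>i<N. \<Sum>j<N. gap_weight i j * (norm (c i))\<^sup>2) = (\<Sum>i<N. (\<Sum>j<N. gap_weight j i) * (norm (c i))\<^sup>2)"
    by (simp only: sum_distrib_right gap_weight_commute)
  also have "\<dots> \<le> (\<Sum>i<N. 2 / 4999 * (norm (c i))\<^sup>2)"
    by (intro sum_mono mult_right_mono sum_gap_weight) auto
  also have "\<dots> = 2 / 4999 * S"
    by (simp only: S_def sum_distrib_left)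
  finally have "(norm f)\<^sup>2 \<le> S + 2 / 4999 * S / 2 + 2 / 4999 * S / 2"
    by simp
  moreover have "0 \<le> S"
    by (simp add: S_def sum_nonneg)
  ultimately show ?thesis
    by (simp add: S_def[symmetric] f_def k_def)
qed

text \<open>A rearrangement of \<open>x\<^sup>2 \<le> (y + z)\<^sup>2 \<le> 2 * y\<^sup>2 + 2 *
  z\<^sup>2\<close>, shaped for a main term \<open>x\<close> perturbed by an error
  \<open>y\<close>.\<close>

lemma half_square_minus_le:
  fixes x y z :: real
  assumes "0 \<le> x" "0 \<le> y" "x - y \<le> z" "0 \<le> z"
  shows "x\<^sup>2 / 2 - y\<^sup>2 \<le> z\<^sup>2"
proof (cases "y \<le> x")
  case True
  have "0 \<le> (x - 2 * y)\<^sup>2" by simp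
  then have "x\<^sup>2 / 2 - y\<^sup>2 \<le> (x - y)\<^sup>2"
    by (simp add: power2_eq_square algebra_simps)
  also have "\<dots> \<le> z\<^sup>2"
    using True assms by (intro power_mono) auto
  finally show ?thesis .
next
  case False
  then have "x\<^sup>2 \<le> y\<^sup>2"
    using assms by (intro power_mono) auto
  then have "x\<^sup>2 / 2 - y\<^sup>2 \<le> 0"
    using zero_le_power2[of x] by linarith
  also have "0 \<le> z\<^sup>2" by simp
  finally show ?thesis .
qed

text \<open>On the shell belonging to \<open>j\<close> the \<open>j\<close>-th kernel dominates the sum of all the others.\<close>

lemma kernel_sum_lower:
  assumes h: "0 < h" and v: "0 < Re v" and j: "j < N"
    and shell: "scale h j / 272 < norm v" "norm v \<le> scale h j"
  shows "(norm (c j))\<^sup>2 / 8 - (272 * (\<Sum>i<N. gap_weight i j * norm (c i)))\<^sup>2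
    \<le> scale h j * (norm (\<Sum>i<N. c i * (of_real (sqrt (scale h i)) / (of_real (scale h i) + v))))\<^sup>2"
proof -
  define t where "t i = scale h i" for i
  define k where "k i = of_real (sqrt (t i)) / (of_real (t i) + v)" for i
  have t: "0 < t i" for i
    using scale_pos[OF h] by (simp add: t_def)
  have ge1: "t i \<le> norm (of_real (t i) + v)" for i
    using complex_Re_le_cmod[of "of_real (t i) + v"] v by simp
  have ge2: "norm v \<le> norm (of_real (t i) + v)" for i
  proof -
    have "(norm v)\<^sup>2 \<le> (norm (of_real (t i) + v))\<^sup>2"
      unfolding cmod_power2 using v t[of i] by (auto intro!: power_mono)
    then show ?thesis
      by (simp add: power2_le_iff_abs_le)
  qed
  have nk: "norm (k i) = sqrt (t i) / norm (of_real (t i) + v)" for i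
    using t[of i] by (simp add: k_def norm_divide)
  \<comment> \<open>For smaller indices the denominator is bounded below by \<open>norm v\<close>,
    hence by \<open>t j / 272\<close>, which costs the factor 272; for larger indices it is bounded
    below by \<open>t i\<close>.\<close>
  have off: "sqrt (t j) * norm (k i) \<le> 272 * gap_weight i j" if ne: "i \<noteq> j" for i
  proof (cases "i < j")
    case True
    have "norm (k i) \<le> sqrt (t i) / (t j / 272)"
      unfolding nk using ge2[of i] shell t[of j] t[of i] t_def
      by (intro divide_left_mono mult_pos_pos) (auto intro: order.strict_trans2[of _ "norm v"])
    then have "sqrt (t j) * norm (k i) \<le> sqrt (t j) * (sqrt (t i) / (t j / 272))"
      by (rule mult_left_mono) (use t[of j] in simp)
    also have "\<dots> = 272 * (sqrt (t i) / sqrt (t j))"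
      using t[of j] real_sqrt_mult_self[of "t j"] by (simp add: field_simps)
    also have "\<dots> = 272 * gap_weight i j"
      using sqrt_scale_ratio[OF h, of i j] True by (simp add: t_def gap_weight_def)
    finally show ?thesis .
  next
    case False
    then have ji: "j < i" using ne by simp
    have "norm (k i) \<le> sqrt (t i) / t i"
      unfolding nk using ge1[of i] t[of i]
      by (intro divide_left_mono mult_pos_pos) (auto intro: order.strict_trans2)
    then have "sqrt (t j) * norm (k i) \<le> sqrt (t j) * (sqrt (t i) / t i)"
      by (rule mult_left_mono) (use t[of j] in simp)
    also have "\<dots> = sqrt (t j) / sqrt (t i)"
      using t[of i] real_sqrt_mult_self[of "t i"] by (simp add: field_simps)
    also have "\<dots> = gap_weight i j"
      using sqrt_scale_ratio[OF h, of j i] ji by (simp add: t_def gap_weight_def)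
    also have "\<dots> \<le> 272 * gap_weight i j"
      using gap_weight_nonneg[of i j] by simp
    finally show ?thesis .
  qed
  \<comment> \<open>On the shell \<open>norm v \<le> t j\<close>, so the denominator is at most
    \<open>2 * t j\<close>. The 1/8 in the claim is \<open>(1 / 2)\<^sup>2 / 2\<close>.\<close>
  have diag: "1 / 2 \<le> sqrt (t j) * norm (k j)"
  proof -
    have "norm (of_real (t j) + v) \<le> 2 * t j"
      using norm_triangle_ineq[of "of_real (t j)" v] shell t[of j] by (simp add: t_def)
    moreover have "0 < norm (of_real (t j) + v)"
      using ge1[of j] t[of j] by linarith
    ultimately have "t j / (2 * t j) \<le> t j / norm (of_real (t j) + v)"
      using t[of j] by (intro divide_left_mono mult_pos_pos) auto
    then show ?thesis
      using t[of j] by (simp add: nk real_sqrt_mult_self)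
  qed
  define y where "y = 272 * (\<Sum>i<N. gap_weight i j * norm (c i))"
  have "(norm (c j) / 2)\<^sup>2 / 2 - y\<^sup>2 \<le> (sqrt (t j) * norm (\<Sum>i<N. c i * k i))\<^sup>2"
  proof (rule half_square_minus_le)
    show "0 \<le> y"
      unfolding y_def by (intro mult_nonneg_nonneg sum_nonneg gap_weight_nonneg) auto
    have "(\<Sum>i<N. c i * k i) = c j * k j + (\<Sum>i\<in>{..<N} - {j}. c i * k i)"
      using j by (intro sum.remove) auto
    then have "norm (c j) * norm (k j) \<le> norm (\<Sum>i<N. c i * k i) + norm (\<Sum>i\<in>{..<N} - {j}. c i * k i)"
      by (metis add_diff_cancel_right' norm_mult norm_triangle_ineq4)
    also have "norm (\<Sum>i\<in>{..<N} - {j}. c i * k i) \<le> (\<Sum>i\<in>{..<N} - {j}. norm (c i) * norm (k i))"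
      by (rule order_trans[OF norm_sum]) (simp add: norm_mult)
    finally have "sqrt (t j) * (norm (c j) * norm (k j)) \<le> sqrt (t j) * (norm (\<Sum>i<N. c i * k i) + (\<Sum>i\<in>{..<N} - {j}. norm (c i) * norm (k i)))"
      using t[of j] by (intro mult_left_mono) auto
    moreover have "norm (c j) * (1 / 2) \<le> norm (c j) * (sqrt (t j) * norm (k j))"
      by (intro mult_left_mono diag) auto
    moreover have "sqrt (t j) * (\<Sum>i\<in>{..<N} - {j}. norm (c i) * norm (k i)) \<le> y"
    proof -
      have "sqrt (t j) * (\<Sum>i\<in>{..<N} - {j}. norm (c i) * norm (k i)) = (\<Sum>i\<in>{..<N} - {j}. norm (c i) * (sqrt (t j) * norm (k i)))"
        by (simp add: sum_distrib_left mult_ac)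
      also have "\<dots> \<le> (\<Sum>i\<in>{..<N} - {j}. norm (c i) * (272 * gap_weight i j))"
        by (intro sum_mono mult_left_mono off) auto
      also have "\<dots> \<le> (\<Sum>i<N. norm (c i) * (272 * gap_weight i j))"
        by (intro sum_mono2) (auto simp: gap_weight_nonneg)
      also have "\<dots> = y"
        by (simp add: y_def sum_distrib_left mult_ac)
      finally show ?thesis .
    qed
    ultimately show "norm (c j) / 2 - y \<le> sqrt (t j) * norm (\<Sum>i<N. c i * k i)"
      by (simp add: algebra_simps)
  qed (use t[of j] in auto)
  then show ?thesis
    using t[of j] by (simp add: power_mult_distrib power_divide y_def k_def t_def)
qed


text \<open>Homogeneity is applied from \<open>t / 272\<close> to \<open>t\<close>, where the
  constant becomes 136/272, so removing the inner disc leaves at least half the mass, and from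
  \<open>h\<close> to \<open>t\<close>, where it bounds that half from below.\<close>

lemma shell_mass:
  assumes hol: "v holomorphic_on ball 0 1" and pos: "\<And>z. norm z < 1 \<Longrightarrow> 0 < Re (v z)"
    and r: "0 < r" "r < 1" and h: "0 < h" and t: "16 * h \<le> t" "t < norm (v 0)"
  shows "t / (272 * h) * measure angle_measure {s. norm (v (of_real r * cis s)) \<le> h}
    \<le> measure angle_measure {s. t / 272 < norm (v (of_real r * cis s)) \<and> norm (v (of_real r * cis s)) \<le> t}"
    and "{s. t / 272 < norm (v (of_real r * cis s)) \<and> norm (v (of_real r * cis s)) \<le> t} \<in> sets borel"
proof -
  define H where "H a = {s. norm (v (of_real r * cis s)) \<le> a}" for a
  have cv: "continuous_on UNIV (\<lambda>s. v (of_real r * cis s))"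
    by (rule continuous_on_compose2[OF holomorphic_on_imp_continuous_on[OF hol]])
       (use r in \<open>auto intro!: continuous_intros simp: norm_mult\<close>)
  have H: "H a \<in> sets borel" for a
    unfolding H_def using cv by (intro borel_closed closed_Collect_le continuous_intros)
  have eq: "{s. t / 272 < norm (v (of_real r * cis s)) \<and> norm (v (of_real r * cis s)) \<le> t} = H t - H (t / 272)"
    by (auto simp: H_def)
  show "{s. t / 272 < norm (v (of_real r * cis s)) \<and> norm (v (of_real r * cis s)) \<le> t} \<in> sets borel"
    unfolding eq using H by auto
  have t0: "0 < t" using h t by simp
  have "measure angle_measure (H t - H (t / 272)) = measure angle_measure (H t) - measure angle_measure (H (t / 272))"
    by (rule angle.finite_measure_Diff) (use H t0 in \<open>simp_all only: sets_angle\<close>, use t0 in \<open>auto simp: H_def\<close>)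
  moreover have "measure angle_measure (H (t / 272)) \<le> measure angle_measure (H t) / 2"
    using mass_homogeneity[OF hol pos r, of "t / 272" t] t t0 by (simp add: H_def)
  moreover have "t / (272 * h) * measure angle_measure (H h) \<le> measure angle_measure (H t) / 2"
    using mass_homogeneity[OF hol pos r h t] h t0 by (simp add: H_def field_simps)
  ultimately show "t / (272 * h) * measure angle_measure {s. norm (v (of_real r * cis s)) \<le> h}
    \<le> measure angle_measure {s. t / 272 < norm (v (of_real r * cis s)) \<and> norm (v (of_real r * cis s)) \<le> t}"
    unfolding eq by (simp add: H_def)
qed

section \<open>Lower bounds for the composition operator\<close>

context
  fixes \<phi> :: "complex \<Rightarrow> complex"
  assumes hol: "\<phi> holomorphic_on ball 0 1" and self: "\<phi> ` ball 0 1 \<subseteq> ball 0 1"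
begin

lemma norm_\<phi>_less: "norm z < 1 \<Longrightarrow> norm (\<phi> z) < 1"
  using self by force

text \<open>The value of \<open>Abs_hardy2\<close> is determined only on \<open>hardy2_set\<close>.
  Boundedness of \<open>f\<close> passes to the composition and puts it there.\<close>

lemma hardy_fun_composition_bounded:
  assumes bd: "\<And>z. norm z < 1 \<Longrightarrow> norm (hardy_fun f z) \<le> B" and z: "norm z < 1"
  shows "hardy_fun (composition_operator \<phi> f) z = hardy_fun f (\<phi> z)"
proof -
  define g where "g z = (if z \<in> ball 0 1 then hardy_fun f (\<phi> z) else 0)" for z
  have "(hardy_fun f \<circ> \<phi>) holomorphic_on ball 0 1"
    by (rule holomorphic_on_compose_gen[OF hol hardy_fun_holomorphic self])
  then have hg: "g holomorphic_on ball 0 1"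
    by (rule holomorphic_transform) (simp add: g_def)
  have "summable (\<lambda>n. (norm (taylor_coeff g n))\<^sup>2)"
    by (rule summable_taylor_coeff_bounded[OF hg, of B]) (use bd norm_\<phi>_less in \<open>auto simp: g_def\<close>)
  with hg have "g \<in> hardy2_set"
    by (auto simp: hardy2_set_def) (auto simp: g_def)
  then have "hardy_fun (Abs_hardy2 g) = g"
    by (rule Abs_hardy2_inverse)
  moreover have "composition_operator \<phi> f = Abs_hardy2 g"
    by (simp add: composition_operator_def g_def[abs_def])
  ultimately show ?thesis
    using z by (simp add: g_def)
qed

lemma hardy_fun_sum: "hardy_fun (sum f A) z = (\<Sum>x\<in>A. hardy_fun (f x) z)"
  by (induction A rule: infinite_finite_induct) (auto simp: hardy_fun_zero hardy_fun_add)

lemma Re_1_minus_pos: "norm \<xi> = 1 \<Longrightarrow> norm w < 1 \<Longrightarrow> 0 < Re (1 - cnj \<xi> * w)"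
  using complex_Re_le_cmod[of "cnj \<xi> * w"] by (simp add: norm_mult)

text \<open>On shell \<open>j\<close> the square modulus is at least \<open>b j / t j\<close>, and
  the shell has mass at least \<open>t j / (272 * h) * m\<close>; the factors \<open>t j\<close>
  cancel. The constant 4352 is 272 times 16, the 16 coming from the loss in the Schur test.\<close>

lemma composition_lower_bound:
  assumes \<xi>: "norm \<xi> = 1" and h: "0 < h" and r: "0 < r" "r < 1"
    and small: "\<And>i. i < N \<Longrightarrow> scale h i < norm (1 - cnj \<xi> * \<phi> 0)"
  shows "measure angle_measure {s. norm (1 - cnj \<xi> * \<phi> (of_real r * cis s)) \<le> h} / (4352 * h) * (\<Sum>i<N. (norm (c i))\<^sup>2)
    \<le> (norm (composition_operator \<phi> (\<Sum>i<N. hscale (c i) (kernel \<xi> (scale h i)))))\<^sup>2"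
proof -
  define f where "f = (\<Sum>i<N. hscale (c i) (kernel \<xi> (scale h i)))"
  define v where "v z = 1 - cnj \<xi> * \<phi> z" for z
  define m where "m = measure angle_measure {s. norm (v (of_real r * cis s)) \<le> h}"
  define t where "t i = scale h i" for i
  have t: "0 < t i" for i
    using scale_pos[OF h] by (simp add: t_def)
  have f: "hardy_fun f w = (\<Sum>i<N. c i * (of_real (sqrt (t i)) / (of_real (t i) + (1 - cnj \<xi> * w))))" if "norm w < 1" for w
    using that hardy_fun_kernel[OF \<xi> t that] by (simp add: f_def hardy_fun_sum hardy_fun_hscale t_def)
  have "norm (hardy_fun f w) \<le> (\<Sum>i<N. norm (c i) * (sqrt (t i) / t i))" if w: "norm w < 1" for w
    unfolding f[OF w]
  proof (rule sum_norm_le)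
    fix i
    have "t i \<le> norm (of_real (t i) + (1 - cnj \<xi> * w))"
      using complex_Re_le_cmod[of "of_real (t i) + (1 - cnj \<xi> * w)"] Re_1_minus_pos[OF \<xi> w] by simp
    then have "sqrt (t i) / norm (of_real (t i) + (1 - cnj \<xi> * w)) \<le> sqrt (t i) / t i"
      using t[of i] by (intro divide_left_mono mult_pos_pos) (auto intro: order.strict_trans2)
    then show "norm (c i * (of_real (sqrt (t i)) / (of_real (t i) + (1 - cnj \<xi> * w)))) \<le> norm (c i) * (sqrt (t i) / t i)"
      using t[of i] by (simp add: norm_mult norm_divide mult_left_mono del: times_divide_eq_right)
  qed
  then have comp: "hardy_fun (composition_operator \<phi> f) z = hardy_fun f (\<phi> z)" if "norm z < 1" for z
    by (rule hardy_fun_composition_bounded[OF _ that])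
  have vhol: "v holomorphic_on ball 0 1"
    unfolding v_def using hol by (intro holomorphic_intros)
  have vpos: "0 < Re (v z)" if "norm z < 1" for z
    unfolding v_def by (rule Re_1_minus_pos[OF \<xi> norm_\<phi>_less[OF that]])
  define E where "E j = {s. t j / 272 < norm (v (of_real r * cis s)) \<and> norm (v (of_real r * cis s)) \<le> t j}" for j
  have E: "t j / (272 * h) * m \<le> measure angle_measure (E j)" "E j \<in> sets borel" if j: "j < N" for j
  proof -
    have "16 * h \<le> t j"
    proof -
      have "16 * h * 1 \<le> 25000000 * h * 5000 ^ (2 * j)"
        using h by (intro mult_mono one_le_power) auto
      then show ?thesis by (simp add: t_def scale_def)
    qed
    moreover have "t j < norm (v 0)"
      using small[OF j] by (simp add: t_def v_def)
    ultimately show "t j / (272 * h) * m \<le> measure angle_measure (E j)" "E j \<in> sets borel"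
      unfolding m_def E_def using shell_mass[OF vhol vpos r h] by auto
  qed
  have disj: "i = j" if s: "s \<in> E i" "s \<in> E j" for i j s
  proof (rule ccontr)
    assume "i \<noteq> j"
    then show False
      using scale_less[OF h, of i j] scale_less[OF h, of j i] s by (cases "i < j") (auto simp: E_def t_def)
  qed
  \<comment> \<open>The pointwise bound is negative where the neighbouring coefficients dominate;
    cutting off at 0 lets it be multiplied by lower bounds for the shell masses.\<close>
  define b where "b j = max 0 ((norm (c j))\<^sup>2 / 8 - (272 * (\<Sum>i<N. gap_weight i j * norm (c i)))\<^sup>2)" for j
  have b0: "0 \<le> b j" for j
    by (simp add: b_def)
  have pw: "(\<Sum>j<N. b j / t j * indicator (E j) s) \<le> (norm (hardy_fun (composition_operator \<phi> f) (of_real r * cis s)))\<^sup>2" for s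
  proof (cases "\<exists>j<N. s \<in> E j")
    case True
    then obtain j where j: "j < N" "s \<in> E j" by blast
    have n: "norm (of_real r * cis s) < 1"
      using r by (simp add: norm_mult)
    have "(\<Sum>i<N. b i / t i * indicator (E i) s) = (\<Sum>i<N. if i = j then b i / t i else 0)"
    proof (rule sum.cong)
      show "b i / t i * indicator (E i) s = (if i = j then b i / t i else 0)" for i
        using j(2) disj[of s i j] by (cases "i = j") (auto simp: indicator_def)
    qed simp
    also have "\<dots> = b j / t j"
      using j by simp
    also have "\<dots> \<le> (norm (hardy_fun (composition_operator \<phi> f) (of_real r * cis s)))\<^sup>2"
    proof -
      have "(norm (c j))\<^sup>2 / 8 - (272 * (\<Sum>i<N. gap_weight i j * norm (c i)))\<^sup>2
          \<le> t j * (norm (hardy_fun (composition_operator \<phi> f) (of_real r * cis s)))\<^sup>2"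
        unfolding comp[OF n] f[OF norm_\<phi>_less[OF n]]
        using kernel_sum_lower[OF h vpos[OF n] j(1), of c] j(2) by (simp add: E_def t_def v_def)
      then have "b j \<le> t j * (norm (hardy_fun (composition_operator \<phi> f) (of_real r * cis s)))\<^sup>2"
        using t[of j] by (simp add: b_def)
      then show ?thesis
        using t[of j] by (simp add: divide_le_eq mult.commute)
    qed
    finally show ?thesis .
  next
    case False
    then show ?thesis by (simp add: indicator_def)
  qed
  \<comment> \<open>Here 5000 has to be large: \<open>(272 * 2 / 4999)\<^sup>2\<close> is below
    1/16, so half of the main part 1/8 survives.\<close>
  have S: "(\<Sum>i<N. (norm (c i))\<^sup>2) / 16 \<le> (\<Sum>j<N. b j)"
  proof -
    have "(\<Sum>j<N. (norm (c j))\<^sup>2 / 8 - 272\<^sup>2 * (\<Sum>i<N. gap_weight i j * norm (c i))\<^sup>2) \<le> (\<Sum>j<N. b j)"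
      by (intro sum_mono) (simp add: b_def power_mult_distrib)
    moreover have "(\<Sum>j<N. (norm (c j))\<^sup>2 / 8 - 272\<^sup>2 * (\<Sum>i<N. gap_weight i j * norm (c i))\<^sup>2)
        = (\<Sum>i<N. (norm (c i))\<^sup>2) / 8 - 272\<^sup>2 * (\<Sum>j<N. (\<Sum>i<N. gap_weight i j * norm (c i))\<^sup>2)"
      by (simp only: sum_subtractf sum_divide_distrib sum_distrib_left)
    moreover have "(\<Sum>j<N. (\<Sum>i<N. gap_weight i j * norm (c i))\<^sup>2) \<le> (2 / 4999)\<^sup>2 * (\<Sum>i<N. (norm (c i))\<^sup>2)"
      by (rule schur_gap_weight)
    moreover have "0 \<le> (\<Sum>i<N. (norm (c i))\<^sup>2)"
      by (simp add: sum_nonneg)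
    ultimately show ?thesis
      by (simp add: power2_eq_square)
  qed
  have "m / (4352 * h) * (\<Sum>i<N. (norm (c i))\<^sup>2) = m / (272 * h) * ((\<Sum>i<N. (norm (c i))\<^sup>2) / 16)"
    by simp
  also have "\<dots> \<le> m / (272 * h) * (\<Sum>j<N. b j)"
    using h by (intro mult_left_mono S) (auto simp: m_def)
  also have "\<dots> = (\<Sum>j<N. b j / t j * (t j / (272 * h) * m))"
    unfolding sum_distrib_left using t by (intro sum.cong refl) (simp add: less_imp_neq[symmetric])
  also have "\<dots> \<le> (\<Sum>j<N. b j / t j * measure angle_measure (E j))"
    by (intro sum_mono mult_left_mono E) (use b0 t in \<open>auto intro!: divide_nonneg_pos\<close>)
  also have "\<dots> = (LINT s|angle_measure. (\<Sum>j<N. b j / t j * indicator (E j) s))"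
    using E(2) by (subst Bochner_Integration.integral_sum) (auto simp: less_top[symmetric] intro!: integrable_mult_right integrable_real_indicator)
  also have "\<dots> \<le> (LINT s|angle_measure. (norm (hardy_fun (composition_operator \<phi> f) (of_real r * cis s)))\<^sup>2)"
  proof (rule integral_mono[OF _ _ pw])
    show "integrable angle_measure (\<lambda>s. \<Sum>j<N. b j / t j * indicator (E j) s)"
      using E(2) by (auto simp: less_top[symmetric] intro!: Bochner_Integration.integrable_sum integrable_mult_right integrable_real_indicator)
    have "continuous_on UNIV (\<lambda>s. hardy_fun (composition_operator \<phi> f) (of_real r * cis s))"
      by (rule continuous_on_compose2[OF holomorphic_on_imp_continuous_on[OF hardy_fun_holomorphic]])
         (use r in \<open>auto intro!: continuous_intros simp: norm_mult\<close>)
    then show "integrable angle_measure (\<lambda>s. (norm (hardy_fun (composition_operator \<phi> f) (of_real r * cis s)))\<^sup>2)"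
      by (intro integrable_angle continuous_intros)
  qed
  also have "\<dots> \<le> (norm (composition_operator \<phi> f))\<^sup>2"
    using r by (intro hardy2_norm_ge_circle_mean) auto
  finally show ?thesis
    by (simp add: m_def v_def f_def)
qed

text \<open>Comparing the lower bound for the images with the upper bound 2 for the Gram form gives
  \<open>\<epsilon>\<^sup>2 = m / (8704 * h)\<close> with 8704 = 2 * 4352. The index is
  \<open>N - 1\<close> because singular numbers are counted from 0.\<close>

lemma mass_le_singular_number:
  assumes comp: "compact_operator (composition_operator \<phi>)"
    and s: "is_singular_numbers (composition_operator \<phi>) s"
    and \<xi>: "norm \<xi> = 1" and h: "0 < h" and r: "0 < r" "r < 1" and N: "0 < N"
    and small: "\<And>i. i < N \<Longrightarrow> scale h i < norm (1 - cnj \<xi> * \<phi> 0)"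
  shows "measure angle_measure {s. norm (1 - cnj \<xi> * \<phi> (of_real r * cis s)) \<le> h} \<le> 8704 * h * (s (N - 1))\<^sup>2"
proof (cases "measure angle_measure {s. norm (1 - cnj \<xi> * \<phi> (of_real r * cis s)) \<le> h} = 0")
  case True
  then show ?thesis using h by simp
next
  case False
  define T where "T = composition_operator \<phi>"
  define m where "m = measure angle_measure {s. norm (1 - cnj \<xi> * \<phi> (of_real r * cis s)) \<le> h}"
  define k where "k i = kernel \<xi> (scale h i)" for i
  define \<epsilon> where "\<epsilon> = sqrt (m / (8704 * h))"
  have m: "0 < m"
    using False by (simp add: m_def zero_less_measure_iff)
  have \<epsilon>: "0 < \<epsilon>" "\<epsilon>\<^sup>2 = m / (8704 * h)"
    using m h by (auto simp: \<epsilon>_def)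
  obtain K where K: "bounded_hardy_operator T K"
    using compact_operator_bounded[OF comp] by (auto simp: T_def)
  interpret compact_hardy_operator T K
    using K comp by (simp add: compact_hardy_operator_def compact_hardy_operator_axioms_def compact_operator_def T_def)
  have low: "m / (4352 * h) * (\<Sum>i<N. (norm (c i))\<^sup>2) \<le> (norm (T (\<Sum>i<N. hscale (c i) (k i))))\<^sup>2" for c
    using composition_lower_bound[OF \<xi> h r small, of N c] by (simp add: m_def T_def k_def)
  \<comment> \<open>Independence of the kernels comes from the lower bound itself: a vanishing
    combination has vanishing image, which forces all coefficients to be 0 since
    \<open>m > 0\<close>.\<close>
  have indep: "c i = 0" if c: "(\<Sum>i<N. hscale (c i) (k i)) = 0" and i: "i < N" for c i
  proof -
    have "m / (4352 * h) * (\<Sum>i<N. (norm (c i))\<^sup>2) \<le> 0"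
      using low[of c] unfolding c T.zero by simp
    then have "(\<Sum>i<N. (norm (c i))\<^sup>2) \<le> 0"
      using m h mult_pos_pos[of "m / (4352 * h)" "\<Sum>i<N. (norm (c i))\<^sup>2"] by (meson divide_pos_pos mult_pos_pos not_le zero_less_numeral)
    then have "(\<Sum>i<N. (norm (c i))\<^sup>2) = 0"
      by (simp add: antisym sum_nonneg)
    then show ?thesis
      using i by (simp add: sum_nonneg_eq_0_iff)
  qed
  have inj: "inj_on k {..<N}"
  proof (rule inj_onI, rule ccontr)
    fix i j assume ij: "i \<in> {..<N}" "j \<in> {..<N}" "k i = k j" "i \<noteq> j"
    define c where "c n = (if n = i then 1 else if n = j then -1 else 0 :: complex)" for n
    have "(\<Sum>n<N. hscale (c n) (k n)) = (\<Sum>n\<in>{i, j}. hscale (c n) (k n))"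
      by (rule sum.mono_neutral_right) (use ij in \<open>auto simp: c_def\<close>)
    also have "\<dots> = hscale 1 (k j) + hscale (-1) (k j)"
      using ij by (simp add: c_def)
    also have "\<dots> = 0"
      by (simp flip: hardy.scale_left_distrib)
    finally have "c i = 0"
      by (rule indep) (use ij in auto)
    then show False by (simp add: c_def)
  qed
  have sum_image: "(\<Sum>v\<in>k ` {..<N}. hscale (u v) v) = (\<Sum>i<N. hscale (u (k i)) (k i))" for u
    by (subst sum.reindex[OF inj]) (simp add: o_def)
  have "hardy.independent (k ` {..<N})"
  proof (rule hardy.independent_if_scalars_zero)
    fix u x assume "(\<Sum>x\<in>k ` {..<N}. hscale (u x) x) = 0" "x \<in> k ` {..<N}"
    then show "u x = 0"
      using indep[of "\<lambda>i. u (k i)"] unfolding sum_image by auto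
  qed simp
  moreover have "\<epsilon> * norm f \<le> norm (T f)" if "f \<in> hardy.span (k ` {..<N})" for f
  proof -
    have "f \<in> range (\<lambda>u. \<Sum>v\<in>k ` {..<N}. hscale (u v) v)"
      using that by (subst (asm) hardy.span_finite) auto
    then obtain u where "f = (\<Sum>i<N. hscale (u (k i)) (k i))"
      unfolding sum_image by blast
    then have "\<exists>c. f = (\<Sum>i<N. hscale (c i) (k i))"
      by (rule exI[of _ "\<lambda>i. u (k i)"])
    then obtain c where f: "f = (\<Sum>i<N. hscale (c i) (k i))"
      by blast
    have "(\<epsilon> * norm f)\<^sup>2 \<le> m / (8704 * h) * (2 * (\<Sum>i<N. (norm (c i))\<^sup>2))"
      unfolding power_mult_distrib \<epsilon>(2)
      using norm_kernel_sum_le[OF \<xi> h, of c N] m h by (intro mult_left_mono) (auto simp: f k_def)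
    also have "\<dots> \<le> (norm (T f))\<^sup>2"
      using low[of c] by (simp add: f)
    finally show ?thesis
      by (rule power2_le_imp_le) simp
  qed
  ultimately have "card (k ` {..<N}) \<le> card {n. \<epsilon> \<le> s n}"
    using s \<epsilon> by (intro card_le_singular_numbers) (auto simp: T_def)
  then have card: "N \<le> card {n. \<epsilon> \<le> s n}"
    by (simp add: card_image[OF inj])
  \<comment> \<open>In a decreasing sequence the indices with value at least \<epsilon> form an
    initial segment, and at least \<open>N\<close> of them include \<open>N - 1\<close>.\<close>
  have "\<epsilon> \<le> s (N - 1)"
  proof (rule ccontr)
    assume less: "\<not> \<epsilon> \<le> s (N - 1)"
    have "decseq s"
      using s by (simp add: is_singular_numbers_def)
    then have "s n < \<epsilon>" if "N - 1 \<le> n" for n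
      using less decseqD[of s "N - 1" n] that by simp
    then have "{n. \<epsilon> \<le> s n} \<subseteq> {..<N - 1}"
      by (force simp: not_less[symmetric])
    then have "card {n. \<epsilon> \<le> s n} \<le> card {..<N - 1}"
      by (intro card_mono) auto
    then show False
      using card N by simp
  qed
  then have "\<epsilon>\<^sup>2 \<le> (s (N - 1))\<^sup>2"
    using \<epsilon> by (intro power_mono) auto
  then have "m \<le> 8704 * h * (s (N - 1))\<^sup>2"
    using h unfolding \<epsilon>(2) by (simp add: field_simps)
  then show ?thesis
    by (simp only: m_def)
qed

end

section \<open>The Carleson function\<close>

lemma circle_measure_eq_distr: "circle_measure = distr angle_measure borel cis"
  by (simp add: circle_measure_def angle_measure_def)

text \<open>With \<open>z = w * cnj \<xi>\<close>, moving from 1 along the circle and then radially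
  to \<open>z\<close> costs at most \<open>h\<close> for the argument and \<open>h\<close> for the
  modulus.\<close>

lemma carleson_window_subset:
  assumes \<xi>: "norm \<xi> = 1" and w: "w \<in> carleson_window \<xi> h"
  shows "norm (1 - cnj \<xi> * w) \<le> 2 * h"
proof -
  define z where "z = w * cnj \<xi>"
  have nz: "norm z = norm w"
    using \<xi> by (simp add: z_def norm_mult)
  have z: "norm z < 1" "1 - h \<le> norm z" "\<bar>Arg z\<bar> \<le> h"
    using w nz by (auto simp: carleson_window_def z_def)
  have "z = of_real (norm z) * cis (Arg z)"
    using rcis_cmod_Arg[of z] by (simp add: rcis_def)
  then have "1 - z = of_real (1 - norm z) + of_real (norm z) * (1 - cis (Arg z))"
    by (simp add: algebra_simps)
  then have "norm (1 - z) \<le> norm (of_real (1 - norm z) :: complex) + norm (of_real (norm z) * (1 - cis (Arg z)))"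
    by (metis norm_triangle_ineq)
  also have "norm (of_real (1 - norm z) :: complex) = 1 - norm z"
    unfolding norm_of_real using z by simp
  also have "norm (of_real (norm z) * (1 - cis (Arg z))) \<le> 1 * \<bar>Arg z\<bar>"
  proof -
    have "norm (1 - cis (Arg z)) \<le> \<bar>Arg z\<bar>"
      using norm_minus_commute[of 1 "cis (Arg z)"] dist_exp_i_1[of "Arg z"] abs_sin_x_le_abs_x[of "Arg z / 2"]
      by (simp add: cis_conv_exp)
    then show ?thesis
      unfolding norm_mult using z by (intro mult_mono) auto
  qed
  finally have "norm (1 - z) \<le> 2 * h"
    using z by linarith
  then show ?thesis
    by (simp add: z_def mult.commute)
qed

text \<open>Transfers a bound uniform in \<open>r < 1\<close> to the boundary. The room between
  \<open>2 * h\<close>, which contains the window, and \<open>3 * h\<close> makes the inequality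
  strict in the limit, so it already holds for radii close to 1.\<close>

lemma boundary_measure_le:
  assumes hol: "\<phi> holomorphic_on ball 0 1" and \<xi>: "norm \<xi> = 1" and h: "0 < h"
    and le: "\<And>r. 0 < r \<Longrightarrow> r < 1 \<Longrightarrow> measure angle_measure {s. norm (1 - cnj \<xi> * \<phi> (of_real r * cis s)) \<le> 3 * h} \<le> B"
  shows "boundary_measure \<phi> (carleson_window \<xi> h) \<le> B"
proof -
  \<comment> \<open>If \<open>Z\<close> is not measurable, its measure is 0, so no appeal to Fatou's theorem is needed.\<close>
  define Z where "Z = {\<zeta> \<in> sphere 0 1. \<exists>w\<in>carleson_window \<xi> h. has_radial_limit \<phi> \<zeta> w}"
  have B: "0 \<le> B"
    by (rule order_trans[OF measure_nonneg le[of "1 / 2"]]) auto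
  show ?thesis
  proof (cases "Z \<in> sets borel")
    case False
    then have "boundary_measure \<phi> (carleson_window \<xi> h) = 0"
      unfolding boundary_measure_def Z_def[symmetric]
      by (intro measure_notin_sets) (simp add: circle_measure_eq_distr)
    then show ?thesis using B by simp
  next
    case True
    define r where "r n = 1 - 1 / real (n + 2)" for n
    have r: "0 < r n" "r n < 1" for n
      by (auto simp: r_def field_simps)
    define H where "H n = {s. norm (1 - cnj \<xi> * \<phi> (of_real (r n) * cis s)) \<le> 3 * h}" for n
    have H: "H n \<in> sets borel" for n
    proof -
      have "continuous_on UNIV (\<lambda>s. \<phi> (of_real (r n) * cis s))"
        by (rule continuous_on_compose2[OF holomorphic_on_imp_continuous_on[OF hol]])
           (use r[of n] in \<open>auto intro!: continuous_intros simp: norm_mult\<close>)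
      then show ?thesis
        unfolding H_def by (intro borel_closed closed_Collect_le continuous_intros)
    qed
    \<comment> \<open>The union of these increasing sets is the lower limit of the
      \<open>H k\<close>; continuity from below preserves the bound.\<close>
    define G where "G n = (\<Inter>k\<in>{n..}. H k)" for n
    have G: "G n \<in> sets borel" for n
      unfolding G_def using H by (intro sets.countable_INT'') auto
    have "measure angle_measure (G n) \<le> B" for n
    proof -
      have "measure angle_measure (G n) \<le> measure angle_measure (H n)"
        using H by (intro angle.finite_measure_mono) (auto simp: G_def)
      also have "\<dots> \<le> B"
        unfolding H_def by (rule le[OF r])
      finally show ?thesis .
    qed
    moreover have "(\<lambda>n. measure angle_measure (G n)) \<longlonglongrightarrow> measure angle_measure (\<Union>n. G n)"
      by (rule angle.finite_Lim_measure_incseq) (use G in \<open>auto simp: incseq_def G_def\<close>)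
    ultimately have *: "measure angle_measure (\<Union>n. G n) \<le> B"
      by (intro LIMSEQ_le_const2) auto
    have "cis -` Z \<subseteq> (\<Union>n. G n)"
    proof
      fix s assume "s \<in> cis -` Z"
      then obtain w where w: "w \<in> carleson_window \<xi> h" "has_radial_limit \<phi> (cis s) w"
        by (auto simp: Z_def)
      have "filterlim r (at_left 1) sequentially"
        unfolding r_def by real_asymp
      then have "(\<lambda>n. \<phi> (of_real (r n) * cis s)) \<longlonglongrightarrow> w"
        using w(2) unfolding has_radial_limit_def by (rule filterlim_compose[rotated])
      then have "(\<lambda>n. norm (1 - cnj \<xi> * \<phi> (of_real (r n) * cis s))) \<longlonglongrightarrow> norm (1 - cnj \<xi> * w)"
        by (intro tendsto_intros)
      moreover have "norm (1 - cnj \<xi> * w) < 3 * h"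
        using carleson_window_subset[OF \<xi> w(1)] h by simp
      ultimately have "\<forall>\<^sub>F n in sequentially. norm (1 - cnj \<xi> * \<phi> (of_real (r n) * cis s)) < 3 * h"
        by (rule order_tendstoD(2))
      then obtain n where "\<And>k. n \<le> k \<Longrightarrow> norm (1 - cnj \<xi> * \<phi> (of_real (r k) * cis s)) < 3 * h"
        by (auto simp: eventually_sequentially)
      then have "s \<in> G n"
        by (auto simp: G_def H_def less_imp_le)
      then show "s \<in> (\<Union>n. G n)" by blast
    qed
    then have "measure angle_measure (cis -` Z) \<le> measure angle_measure (\<Union>n. G n)"
      using G by (intro angle.finite_measure_mono) auto
    also note *
    also have "measure angle_measure (cis -` Z) = boundary_measure \<phi> (carleson_window \<xi> h)"
    proof -
      have "cis \<in> borel_measurable borel"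
        by (intro borel_measurable_continuous_onI continuous_intros)
      then show ?thesis
        unfolding boundary_measure_def Z_def[symmetric] circle_measure_eq_distr
        using True by (subst measure_distr) auto
    qed
    finally show ?thesis .
  qed
qed

text \<open>Olivier's theorem: by monotonicity \<open>n - N\<close> copies of \<open>f n\<close> fit
  below a small tail, and \<open>Suc n \<le> 2 * (n - N)\<close> once \<open>n\<close> exceeds
  \<open>2 * N\<close>. This is what turns the big-O rate into little-o.\<close>

lemma summable_decseq_LIMSEQ_mult:
  fixes f :: "nat \<Rightarrow> real"
  assumes sum: "summable f" and dec: "decseq f" and nn: "\<And>n. 0 \<le> f n"
  shows "(\<lambda>n. real (Suc n) * f n) \<longlonglongrightarrow> 0"
proof (rule LIMSEQ_I)
  fix e :: real assume e: "0 < e"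
  obtain N where N: "\<And>n. N \<le> n \<Longrightarrow> norm (\<Sum>i. f (i + n)) < e / 4"
    using suminf_exist_split[OF _ sum, of "e / 4"] e by auto
  show "\<exists>no. \<forall>n\<ge>no. norm (real (Suc n) * f n - 0) < e"
  proof (intro exI allI impI)
    fix n assume n: "2 * N + 1 \<le> n"
    have "real (n - N) * f n = (\<Sum>i<n - N. f n)"
      by simp
    also have "\<dots> \<le> (\<Sum>i<n - N. f (i + N))"
      by (intro sum_mono decseqD[OF dec]) auto
    also have "\<dots> \<le> (\<Sum>i. f (i + N))"
      using sum by (intro sum_le_suminf) (auto simp: nn summable_iff_shift)
    also have "\<dots> < e / 4"
      using N[of N] by simp
    finally have "real (n - N) * f n < e / 4" .
    moreover have "real (Suc n) * f n \<le> (2 * real (n - N)) * f n"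
      using n by (intro mult_right_mono nn) (auto simp: of_nat_diff)
    ultimately show "norm (real (Suc n) * f n - 0) < e"
      using nn[of n] e by (simp del: of_nat_Suc)
  qed
qed

theorem proposition3p4:
  fixes \<phi> :: "complex \<Rightarrow> complex" and p :: real
  assumes "\<phi> holomorphic_on ball 0 1"
    and "\<phi> ` ball 0 1 \<subseteq> ball 0 1"
    and "p > 0"
    and "composition_operator \<phi> \<in> schatten_class p"
  shows "carleson_function \<phi> \<in> o[at_right 0](\<lambda>h. h * (ln (1 / h)) powr (- 2 / p))"
proof (rule landau_o.smallI)
  fix \<epsilon> :: real assume \<epsilon>: "0 < \<epsilon>"
  note p = \<open>p > 0\<close>
  obtain s where comp: "compact_operator (composition_operator \<phi>)"
    and s: "is_singular_numbers (composition_operator \<phi>) s" and sum: "summable (\<lambda>n. s n powr p)"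
    using assms(4) by (auto simp: schatten_class_def)
  have dec: "decseq s" and "s \<longlonglongrightarrow> 0"
    using s by (auto simp: is_singular_numbers_def)
  then have s0: "0 \<le> s n" for n
    by (rule decseq_ge)
  have dec': "decseq (\<lambda>n. s n powr p)"
    using decseqD[OF dec] s0 p by (auto simp: decseq_def intro!: powr_mono2)
  have lim: "(\<lambda>n. real (Suc n) * s n powr p) \<longlonglongrightarrow> 0"
    by (rule summable_decseq_LIMSEQ_mult[OF sum dec']) simp
  define \<delta> where "\<delta> = 1 - norm (\<phi> 0)"
  have \<delta>: "0 < \<delta>"
    using assms(2) by (force simp: \<delta>_def)
  define L where "L = ln (5000 :: real)"
  have L: "0 < L" by (simp add: L_def)
  \<comment> \<open>Three times 8704, since the mass estimate is used at
    \<open>3 * h\<close>.\<close>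
  define C :: real where "C = 26112"
  \<comment> \<open>Chosen backwards: after division by the lower bound
    \<open>ln (1 / h) / (4 * L)\<close> for the dimension and raising to the power
    \<open>2 / p\<close>, exactly \<open>\<epsilon> / C\<close> times the required power of the
    logarithm remains.\<close>
  define \<eta> where "\<eta> = (\<epsilon> / C) powr (p / 2) / (4 * L)"
  have \<eta>: "0 < \<eta>"
    using \<epsilon> L by (simp add: \<eta>_def C_def)
  obtain N0 where N0: "\<And>n. N0 \<le> n \<Longrightarrow> real (Suc n) * s n powr p < \<eta>"
    using order_tendstoD(2)[OF lim \<eta>] by (auto simp: eventually_sequentially)
  \<comment> \<open>The largest number of scales with
    \<open>4 * h * 5000 ^ (2 * N) \<le> \<delta>\<close>, once \<open>h\<close> is small. All scales
    built from \<open>3 * h\<close> then stay below \<delta>, a lower bound for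
    \<open>norm (1 - cnj \<xi> * \<phi> 0)\<close> that is uniform in \<xi>.\<close>
  define N where "N h = nat \<lfloor>ln (\<delta> / (4 * h)) / (2 * L)\<rfloor>" for h
  have "\<forall>\<^sub>F h in at_right 0. ln (\<delta> / (4 * h)) / (2 * L) \<ge> real N0 + 1"
    using \<delta> L by real_asymp
  \<comment> \<open>Halving the coefficient of the logarithm absorbs \<delta>, the factor 4 and the
    rounding down.\<close>
  moreover have "\<forall>\<^sub>F h in at_right 0. ln (\<delta> / (4 * h)) / (2 * L) - 1 \<ge> ln (1 / h) / (4 * L)"
    using \<delta> L by real_asymp
  moreover have "\<forall>\<^sub>F h in at_right 0. (0::real) < h \<and> h < 1"
    using eventually_at_right_real[of 0 1] by (auto elim: eventually_mono)
  ultimately show "\<forall>\<^sub>F h in at_right 0. norm (carleson_function \<phi> h) \<le> \<epsilon> * norm (h * ln (1 / h) powr (- 2 / p))"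
  proof eventually_elim
    case (elim h)
    define n where "n = N h"
    have h: "0 < h" "h < 1" using elim by auto
    have lnh: "0 < ln (1 / h)" using h by simp
    have "0 \<le> ln (\<delta> / (4 * h)) / (2 * L)"
      using elim(1) by linarith
    then have n: "real n = of_int \<lfloor>ln (\<delta> / (4 * h)) / (2 * L)\<rfloor>"
      by (simp add: n_def N_def)
    have n_le: "real n \<le> ln (\<delta> / (4 * h)) / (2 * L)"
      unfolding n by (rule of_int_floor_le)
    have n_ge: "ln (1 / h) / (4 * L) \<le> real n" "real N0 < real n"
      using elim(1,2) real_of_int_floor_gt_diff_one[of "ln (\<delta> / (4 * h)) / (2 * L)"]
      unfolding n by linarith+
    have n0: "0 < n"
      using n_ge by simp
    have small: "scale (3 * h) i < norm (1 - cnj \<xi> * \<phi> 0)" if \<xi>: "norm \<xi> = 1" and i: "i < n" for \<xi> i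
    proof -
      have "scale (3 * h) i \<le> 3 * h * 5000 ^ (2 * n)"
        unfolding scale_def using h i by (intro mult_left_mono power_increasing) auto
      also have "(5000 :: real) ^ (2 * n) = exp (real n * (2 * L))"
      proof -
        have "exp (real (2 * n) * L) = 5000 ^ (2 * n)"
          unfolding exp_of_nat_mult by (simp add: L_def)
        then show ?thesis
          by (simp add: mult_ac)
      qed
      also have "exp (real n * (2 * L)) \<le> exp (ln (\<delta> / (4 * h)))"
        using n_le L by (simp add: field_simps)
      also have "\<dots> = \<delta> / (4 * h)"
        using \<delta> h by simp
      finally have "scale (3 * h) i \<le> 3 / 4 * \<delta>"
        using h by simp
      also have "\<dots> < \<delta>"
        using \<delta> by simp
      also have "\<dots> \<le> norm (1 - cnj \<xi> * \<phi> 0)"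
        using norm_triangle_ineq2[of 1 "cnj \<xi> * \<phi> 0"] \<xi> by (simp add: \<delta>_def norm_mult)
      finally show ?thesis .
    qed
    have bound: "boundary_measure \<phi> (carleson_window \<xi> h) \<le> C * h * (s (n - 1))\<^sup>2" if "\<xi> \<in> sphere 0 1" for \<xi>
    proof (rule boundary_measure_le[OF assms(1) _ h(1)])
      show \<xi>: "norm \<xi> = 1" using that by simp
      show "measure angle_measure {t. norm (1 - cnj \<xi> * \<phi> (of_real r * cis t)) \<le> 3 * h} \<le> C * h * (s (n - 1))\<^sup>2"
        if "0 < r" "r < 1" for r
        using mass_le_singular_number[OF assms(1,2) comp s \<xi> _ that n0 small[OF \<xi>]] h by (simp add: C_def)
    qed
    have "carleson_function \<phi> h \<le> C * h * (s (n - 1))\<^sup>2"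
      unfolding carleson_function_def by (rule cSUP_least) (use bound in auto)
    moreover have "0 \<le> carleson_function \<phi> h"
      unfolding carleson_function_def
      by (rule cSUP_upper2[of _ _ 1]) (use bound in \<open>auto intro!: bdd_aboveI2 simp: boundary_measure_def\<close>)
    moreover have "C * h * (s (n - 1))\<^sup>2 \<le> \<epsilon> * (h * ln (1 / h) powr (- 2 / p))"
    proof -
      \<comment> \<open>The index \<open>n - 1\<close>, whose successor is \<open>n\<close>, is at
        least \<open>N0\<close> because \<open>N0 < n\<close>.\<close>
      have "real n * s (n - 1) powr p < \<eta>"
        using N0[of "n - 1"] n_ge n0 by simp
      then have "s (n - 1) powr p \<le> \<eta> / real n"
        using n0 by (simp add: field_simps)
      also have "\<dots> \<le> \<eta> / (ln (1 / h) / (4 * L))"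
        using n_ge(1) n0 lnh L \<eta> by (intro divide_left_mono) auto
      also have "\<dots> = (\<epsilon> / C) powr (p / 2) / ln (1 / h)"
        using L by (simp add: \<eta>_def)
      finally have "(s (n - 1) powr p) powr (2 / p) \<le> ((\<epsilon> / C) powr (p / 2) / ln (1 / h)) powr (2 / p)"
        using p by (intro powr_mono2) auto
      also have "(s (n - 1) powr p) powr (2 / p) = (s (n - 1))\<^sup>2"
        using p s0[of "n - 1"] by (simp add: powr_powr)
      also have "((\<epsilon> / C) powr (p / 2) / ln (1 / h)) powr (2 / p) = (\<epsilon> / C) * ln (1 / h) powr (- 2 / p)"
      proof -
        have "(a powr (p / 2) / l) powr (2 / p) = a * l powr (- 2 / p)" if "0 < a" "0 < l" for a l :: real
          using p that by (simp add: powr_divide powr_powr powr_minus_divide)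
        then show ?thesis
          using \<epsilon> lnh by (simp add: C_def del: ln_div)
      qed
      finally have "C * h * (s (n - 1))\<^sup>2 \<le> C * h * ((\<epsilon> / C) * ln (1 / h) powr (- 2 / p))"
        using h by (intro mult_left_mono) (auto simp: C_def)
      then show ?thesis
        by (simp add: C_def mult_ac)
    qed
    moreover have "norm (h * ln (1 / h) powr (- 2 / p)) = h * ln (1 / h) powr (- 2 / p)"
      unfolding real_norm_def using h by (intro abs_of_nonneg mult_nonneg_nonneg) auto
    ultimately show ?case
      by simp
  qed
qed

end
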